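(* Let $L$ be a virtual link diagram with $e$ classical crossings, let $s$ be a state of $L$, let $G_L^s$ be the signed ribbon graph corresponding to $s$, and let $v:=v(G_L^s)$, $k:=k(G_L^s)$. Then $e=e(G_L^s)$ and the Kauffman bracket of $L$ satisfies $$[L](A,B,d) = A^e\left( x^k y^v z^{v+1} R_{G_L^s}(x,y,z)\Big|_{x=\frac{Ad}{B},\ y=\frac{Bd}{A},\ z=\frac{1}{d}}\right),$$ where $R$ is the signed Bollobás–Riordan polynomial.
   Context: **Ribbon graphs.** A ribbon graph $G$ is a (possibly non-orientable) surface with boundary, represented as the union of two finite sets of closed topological discs, vertices $V(G)$ and edges $E(G)$, such that: vertices and edges intersect in disjoint line segments; each such segment lies on the boundary of precisely one vertex and precisely one edge; every edge contains exactly two such segments. Ribbon graphs are considered up to homeomorphism preserving the decomposition. $G$ is signed if it comes with a sign function $\varepsilon:E(G)\to\{\pm1\}$. **Arrow presentation.** Equivalently, a ribbon graph is a collection of disjoint oriented circles (one per vertex) carrying labeled arrows, each label occurring exactly twice, modulo: reversing all arrows on a circle together with the cyclic order of arrows along it; reversing both arrows with the same label. To recover the surface, fill each circle with a vertex-disc and, for each label, attach a rectangle (the edge) along a pair of opposite sides to the two arrows with that label, so that both arrows are coherent with one orientation of the boundary of the rectangle. **Signed Bollobás–Riordan polynomial.** $v(G)=|V(G)|$, $e(G)=|E(G)|$, $k(G)$ is the number of connected components, $r(G)=v(G)-k(G)$, $n(G)=e(G)-r(G)$, $f(G)$ is the number of connected components of the boundary of the surface $G$. $\mathcal F(G)$ is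 the set of spanning subgraphs (all vertices, a subset of the edges). For $F\in\mathcal F(G)$, $\overline F$ is the spanning subgraph with the complementary edge set, $e_-(F)$ is the number of negative edges of $F$, $s(F)=\frac{e_-(F)-e_-(\overline F)}{2}$. Then $$R_G(x,y,z):=\sum_{F\in\mathcal F(G)} x^{r(G)-r(F)+s(F)}\,y^{n(F)-s(F)}\,z^{k(F)-f(F)+n(F)}.$$ If half-integer exponents occur, the substitution (which satisfies $xyz^2=1$) is understood with $x^{1/2}y^{1/2}z=1$, i.e. $x^{1/2}y^{1/2}=d$ and $x^{1/2}y^{-1/2}=A/B$. **Virtual link diagrams, states, Kauffman bracket.** A virtual link diagram is like an ordinary planar link diagram except that some crossings are designated virtual (to be ignored, as artifacts of the planar drawing); the others are classical. At a classical crossing, the $A$-splitting is obtained by joining the two vertical angles swept out by the overcrossing arc when it is rotated counterclockwise toward the undercrossing arc; the $B$-splitting joins the other two vertical angles. A state $s$ of $L$ is a choice of an $A$- or $B$-splitting at each classical crossing; $\mathcal S(L)$ is the set of states. $\alpha(s),\beta(s)$ are the numbers of $A$- and $B$-splittings in $s$, and $\delta(s)$ is the number of components (state circles) of the curve obtained by splitting $L$ according to $s$ (virtual crossings do not connect components). The Kauffman bracket is $$[L](A,B,d):=\sum_{s\in\mathcal S(L)}A^{\alpha(s)}B^{\beta(s)}d^{\,\delta(s)-1}.$$ **The ribbon graph $G_L^s$.** Its vertices are obtained by gluing a disc to each state circle of $s$ (regarded as an abstract circle, ignoring virtual crossings). For each classical crossing place near it a small planar band (rectangle) connecting the two strands of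 the splitting of $s$; these bands are the edges. The orientation of the plane induces orientations of the bands and hence arrows on the state circles along the two sides where the band meets them; the resulting circles with arrows (labeled by crossings) determine $G_L^s$ by its arrow presentation. The edge has sign $+1$ if the crossing is resolved by an $A$-splitting in $s$ and $-1$ if by a $B$-splitting. *)

theory Defs
  imports Complex_Main "HOL-Library.FuncSet"
begin

definition graph_components :: "'a set \<Rightarrow> ('a \<times> 'a) set \<Rightarrow> 'a set set" where
  "graph_components S R = S // ((R \<union> R\<inverse>) \<inter> S \<times> S)\<^sup>*"


section \<open>Signed ribbon graphs\<close>

text \<open>
  A ribbon graph is given by an arrow presentation. Each oriented circle (one per vertex) is a
  cyclic word listing, in the order in which they are met along the circle, the labels of its
  arrows; the Boolean tells whether the arrow points in the direction of the circle. A circle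
  without arrows is the empty word. The labels are the edges.
\<close>

record 'e signed_ribbon_graph =
  circles :: "('e \<times> bool) list list"
  edge_sign :: "'e \<Rightarrow> int"

definition edges :: "'e signed_ribbon_graph \<Rightarrow> 'e set" where
  "edges G = fst ` set (concat (circles G))"

definition signed_ribbon_graph :: "'e signed_ribbon_graph \<Rightarrow> bool" where
  "signed_ribbon_graph G \<longleftrightarrow>
     (\<forall>c \<in> edges G. count_list (map fst (concat (circles G))) c = 2 \<and> edge_sign G c \<in> {1, -1})"

definition spanning_subgraph :: "'e signed_ribbon_graph \<Rightarrow> 'e set \<Rightarrow> 'e signed_ribbon_graph" where
  "spanning_subgraph G F = G\<lparr>circles := map (filter (\<lambda>a. fst a \<in> F)) (circles G)\<rparr>"

definition num_vertices :: "'e signed_ribbon_graph \<Rightarrow> nat" where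
  "num_vertices G = length (circles G)"

definition num_edges :: "'e signed_ribbon_graph \<Rightarrow> nat" where
  "num_edges G = card (edges G)"

definition num_components :: "'e signed_ribbon_graph \<Rightarrow> nat" where
  "num_components G = card (graph_components {..<length (circles G)}
     {(i, j). fst ` set (circles G ! i) \<inter> fst ` set (circles G ! j) \<noteq> {}})"

definition ribbon_rank :: "'e signed_ribbon_graph \<Rightarrow> int" where
  "ribbon_rank G = int (num_vertices G) - int (num_components G)"

definition ribbon_nullity :: "'e signed_ribbon_graph \<Rightarrow> int" where
  "ribbon_nullity G = int (num_edges G) - ribbon_rank G"

text \<open>
  Boundary of the surface. An arrow is addressed by its circle \<open>i\<close> and its position \<open>j\<close> on that
  circle; it has two end points, \<open>(i, j, False)\<close> being the first and \<open>(i, j, True)\<close> the second one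
  met along the circle. The boundary of the surface is made of the arcs of the circles between
  consecutive arrows and, for each edge, the two free sides of its rectangle. As both arrows of the
  edge are coherent with one orientation of the boundary of the rectangle, each free side leads from
  the head of one arrow to the tail of the other. A circle without arrows is itself a boundary
  component.
\<close>

definition arrows :: "'e signed_ribbon_graph \<Rightarrow> (nat \<times> nat) set" where
  "arrows G = {(i, j). i < length (circles G) \<and> j < length (circles G ! i)}"

definition arrow_label :: "'e signed_ribbon_graph \<Rightarrow> nat \<times> nat \<Rightarrow> 'e" where
  "arrow_label G = (\<lambda>(i, j). fst (circles G ! i ! j))"

definition arrow_head :: "'e signed_ribbon_graph \<Rightarrow> nat \<times> nat \<Rightarrow> nat \<times> nat \<times> bool" where
  "arrow_head G = (\<lambda>(i, j). (i, j, snd (circles G ! i ! j)))"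

definition arrow_tail :: "'e signed_ribbon_graph \<Rightarrow> nat \<times> nat \<Rightarrow> nat \<times> nat \<times> bool" where
  "arrow_tail G = (\<lambda>(i, j). (i, j, \<not> snd (circles G ! i ! j)))"

definition arrow_ends :: "'e signed_ribbon_graph \<Rightarrow> (nat \<times> nat \<times> bool) set" where
  "arrow_ends G = {(i, j, b). (i, j) \<in> arrows G}"

definition free_arcs :: "'e signed_ribbon_graph \<Rightarrow> ((nat \<times> nat \<times> bool) \<times> (nat \<times> nat \<times> bool)) set" where
  "free_arcs G = {((i, j, True), (i, Suc j mod length (circles G ! i), False)) | i j. (i, j) \<in> arrows G}"

definition free_sides :: "'e signed_ribbon_graph \<Rightarrow> ((nat \<times> nat \<times> bool) \<times> (nat \<times> nat \<times> bool)) set" where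
  "free_sides G = {(arrow_head G p, arrow_tail G q) | p q.
     p \<in> arrows G \<and> q \<in> arrows G \<and> p \<noteq> q \<and> arrow_label G p = arrow_label G q}"

definition num_boundary :: "'e signed_ribbon_graph \<Rightarrow> nat" where
  "num_boundary G = card (graph_components (arrow_ends G) (free_arcs G \<union> free_sides G))
     + card {i. i < length (circles G) \<and> circles G ! i = []}"


section \<open>The signed Bollobas-Riordan polynomial\<close>

definition num_neg_edges :: "'e signed_ribbon_graph \<Rightarrow> nat" where
  "num_neg_edges G = card {c \<in> edges G. edge_sign G c = -1}"

definition sign_shift :: "'e signed_ribbon_graph \<Rightarrow> 'e set \<Rightarrow> rat" where
  "sign_shift G F =
     (of_nat (num_neg_edges (spanning_subgraph G F))
        - of_nat (num_neg_edges (spanning_subgraph G (edges G - F)))) / 2"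

definition half_integer_exponents :: "'e signed_ribbon_graph \<Rightarrow> bool" where
  "half_integer_exponents G \<longleftrightarrow> (\<exists>F \<subseteq> edges G. sign_shift G F \<notin> \<int>)"

text \<open>
  The power of \<open>x\<close> with exponent \<open>q\<close>, an integer or half an odd integer, where \<open>t\<close> stands for the
  chosen value of the square root of \<open>x\<close>; \<open>t\<close> is used only if \<open>q\<close> is not an integer.
\<close>

definition half_power :: "'a::field \<Rightarrow> 'a \<Rightarrow> rat \<Rightarrow> 'a" where
  "half_power x t q = (if q \<in> \<int> then x powi \<lfloor>q\<rfloor> else t powi \<lfloor>2 * q\<rfloor>)"

text \<open>The arguments \<open>t\<close> and \<open>u\<close> are the values of the square roots of \<open>x\<close> and \<open>y\<close>.\<close>

definition bollobas_riordan ::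
  "'e signed_ribbon_graph \<Rightarrow> 'a::field \<Rightarrow> 'a \<Rightarrow> 'a \<Rightarrow> 'a \<Rightarrow> 'a \<Rightarrow> 'a" where
  "bollobas_riordan G x t y u z = (\<Sum>F \<in> Pow (edges G).
     let H = spanning_subgraph G F; \<sigma> = sign_shift G F in
       half_power x t (of_int (ribbon_rank G - ribbon_rank H) + \<sigma>)
     * half_power y u (of_int (ribbon_nullity H) - \<sigma>)
     * z powi (int (num_components H) - int (num_boundary H) + ribbon_nullity H))"


section \<open>Virtual link diagrams\<close>

text \<open>
  A diagram is a plane 4-valent graph, possibly with additional closed curves that meet no crossing.
  The four half-edges at a crossing \<open>c\<close> are \<open>(c, 0), (c, 1), (c, 2), (c, 3)\<close> in counterclockwise
  order. At a classical crossing the overcrossing arc consists of \<open>(c, 0)\<close> and \<open>(c, 2)\<close>.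
  The map \<open>across\<close> sends a half-edge to the other half of its edge.
\<close>

record 'c virtual_link_diagram =
  crossings :: "'c set"
  virtual :: "'c set"
  across :: "'c \<times> nat \<Rightarrow> 'c \<times> nat"
  loops :: nat

definition classical :: "'c virtual_link_diagram \<Rightarrow> 'c set" where
  "classical L = crossings L - virtual L"

definition half_edges :: "'c virtual_link_diagram \<Rightarrow> ('c \<times> nat) set" where
  "half_edges L = crossings L \<times> {..<4}"

definition next_half_edge :: "'c \<times> nat \<Rightarrow> 'c \<times> nat" where
  "next_half_edge = (\<lambda>(c, i). (c, Suc i mod 4))"

definition num_faces :: "'c virtual_link_diagram \<Rightarrow> nat" where
  "num_faces L = card (graph_components (half_edges L) {(h, next_half_edge (across L h)) | h. h \<in> half_edges L})"

text \<open>
  Planarity of the 4-valent graph is Euler's formula (with twice as many edges as crossings), summed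
  over the connected components, each drawn on a sphere of its own.
\<close>

definition planar :: "'c virtual_link_diagram \<Rightarrow> bool" where
  "planar L \<longleftrightarrow>
     int (card (crossings L)) - 2 * int (card (crossings L)) + int (num_faces L)
       = 2 * int (card (graph_components (crossings L) {(fst h, fst (across L h)) | h. h \<in> half_edges L}))"

definition virtual_link_diagram :: "'c virtual_link_diagram \<Rightarrow> bool" where
  "virtual_link_diagram L \<longleftrightarrow>
     finite (crossings L) \<and> virtual L \<subseteq> crossings L \<and>
     (\<forall>h \<in> half_edges L. across L h \<in> half_edges L \<and> across L h \<noteq> h \<and> across L (across L h) = h) \<and>
     planar L"


section \<open>States and the Kauffman bracket\<close>

datatype splitting = Split_A | Split_B

definition states :: "'c virtual_link_diagram \<Rightarrow> ('c \<Rightarrow> splitting) set" where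
  "states L = classical L \<rightarrow>\<^sub>E UNIV"

text \<open>
  Rotated counterclockwise, the overcrossing arc sweeps out the angle between half-edges 0 and 1 and
  the one between 2 and 3. The A-splitting joins these two angles, hence its strands connect 1 with 2
  and 3 with 0. Those of the B-splitting connect 0 with 1 and 2 with 3. The following predicate holds
  at the half-edge from which the strand leads to the next one in counterclockwise order.
\<close>

definition strand_start :: "splitting \<Rightarrow> nat \<Rightarrow> bool" where
  "strand_start m i = (case m of Split_A \<Rightarrow> odd i | Split_B \<Rightarrow> even i)"

definition through :: "'c virtual_link_diagram \<Rightarrow> ('c \<Rightarrow> splitting) \<Rightarrow> 'c \<times> nat \<Rightarrow> 'c \<times> nat" where
  "through L s = (\<lambda>(c, i).
     (c, if c \<in> virtual L then (i + 2) mod 4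
         else if strand_start (s c) i then (i + 1) mod 4
         else (i + 3) mod 4))"

text \<open>The state circles that meet at least one crossing, each as its set of half-edges.\<close>

definition state_circles :: "'c virtual_link_diagram \<Rightarrow> ('c \<Rightarrow> splitting) \<Rightarrow> ('c \<times> nat) set set" where
  "state_circles L s = graph_components (half_edges L)
     ({(h, across L h) | h. h \<in> half_edges L} \<union> {(h, through L s h) | h. h \<in> half_edges L})"

definition num_state_circles :: "'c virtual_link_diagram \<Rightarrow> ('c \<Rightarrow> splitting) \<Rightarrow> nat" where
  "num_state_circles L s = card (state_circles L s) + loops L"

definition kauffman_bracket :: "'c virtual_link_diagram \<Rightarrow> 'a::field \<Rightarrow> 'a \<Rightarrow> 'a \<Rightarrow> 'a" where
  "kauffman_bracket L A B d = (\<Sum>s \<in> states L.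
     A ^ card {c \<in> classical L. s c = Split_A} * B ^ card {c \<in> classical L. s c = Split_B}
       * d powi (int (num_state_circles L s) - 1))"


section \<open>The ribbon graph of a state\<close>

text \<open>
  A traversal of a state circle in one of its two directions, recorded by the half-edges through
  which it enters the successive crossings.
\<close>

definition traversal ::
  "'c virtual_link_diagram \<Rightarrow> ('c \<Rightarrow> splitting) \<Rightarrow> ('c \<times> nat) list \<Rightarrow> bool" where
  "traversal L s hs \<longleftrightarrow> hs \<noteq> [] \<and> distinct hs \<and> set hs \<subseteq> half_edges L \<and>
     (\<forall>i < length hs. across L (through L s (hs ! i)) = hs ! (Suc i mod length hs))"

definition traversed_circle ::
  "'c virtual_link_diagram \<Rightarrow> ('c \<Rightarrow> splitting) \<Rightarrow> ('c \<times> nat) list \<Rightarrow> ('c \<times> nat) set" where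
  "traversed_circle L s hs = set hs \<union> through L s ` set hs"

text \<open>
  The band at a classical crossing lies in the angles joined by the splitting. With its boundary
  oriented counterclockwise it runs along each of the two strands so as to have the centre of the
  crossing on its left, that is, along the strand from a half-edge to the next one in counterclockwise
  order.
\<close>

definition arrow_word ::
  "'c virtual_link_diagram \<Rightarrow> ('c \<Rightarrow> splitting) \<Rightarrow> ('c \<times> nat) list \<Rightarrow> ('c \<times> bool) list" where
  "arrow_word L s hs =
     map (\<lambda>(c, i). (c, strand_start (s c) i)) (filter (\<lambda>(c, i). c \<in> classical L) hs)"

text \<open>
  \<open>G\<close> is an arrow presentation of the ribbon graph of the state \<open>s\<close>. The order of the circles and the
  direction and starting point chosen on each of them are arbitrary.
\<close>

definition state_ribbon_graph ::
  "'c virtual_link_diagram \<Rightarrow> ('c \<Rightarrow> splitting) \<Rightarrow> 'c signed_ribbon_graph \<Rightarrow> bool" where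
  "state_ribbon_graph L s G \<longleftrightarrow>
     signed_ribbon_graph G \<and>
     (\<exists>hss. (\<forall>hs \<in> set hss. traversal L s hs) \<and>
        distinct (map (traversed_circle L s) hss) \<and>
        traversed_circle L s ` set hss = state_circles L s \<and>
        circles G = map (arrow_word L s) hss @ replicate (loops L) []) \<and>
     (\<forall>c \<in> classical L. edge_sign G c = (case s c of Split_A \<Rightarrow> 1 | Split_B \<Rightarrow> -1))"

subsection \<open>Every state has a ribbon graph\<close>

lemma orbit_list_exists:
  fixes a t :: "'b \<Rightarrow> 'b"
  assumes fin: "finite H" and h: "h \<in> H"
    and a: "\<And>x. x \<in> H \<Longrightarrow> a x \<in> H \<and> a x \<noteq> x \<and> a (a x) = x"
    and t: "\<And>x. x \<in> H \<Longrightarrow> t x \<in> H \<and> t x \<noteq> x \<and> t (t x) = x"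
  obtains hs where "hs \<noteq> []" "distinct hs" "set hs \<subseteq> H" "hs ! 0 = h"
    "\<And>i. i < length hs \<Longrightarrow> a (t (hs ! i)) = hs ! (Suc i mod length hs)"
proof -
  define p where "p i = ((a \<circ> t) ^^ i) h" for i
  have p0: "p 0 = h" and pS: "p (Suc i) = a (t (p i))" for i
    by (simp_all add: p_def)
  have pH: "p i \<in> H" for i
    by (induction i) (use h a t p0 pS in auto)
  have inj: "x = y" if "x \<in> H" "y \<in> H" "a (t x) = a (t y)" for x y
    using that a t by metis
  have period: "p (j - i) = h" if "i \<le> j" "p i = p j" for i j
    using that
  proof (induction i arbitrary: j)
    case 0 then show ?case by (simp add: p0)
  next
    case (Suc i)
    obtain j' where j: "j = Suc j'" using Suc.prems(1) by (cases j) simp_all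
    then have "p i = p j'" using Suc.prems pS inj pH by metis
    then show ?case using Suc.IH[of j'] Suc.prems(1) j by simp
  qed
  have "\<not> inj p"
    using fin pH by (metis finite_imageD finite_subset image_subsetI infinite_UNIV_nat)
  then obtain i j where "i < j" "p i = p j"
    by (metis injI linorder_neqE_nat)
  then have ex: "\<exists>n. 0 < n \<and> p n = h"
    using period by (metis less_imp_le_nat zero_less_diff)
  define n where "n = (LEAST n. 0 < n \<and> p n = h)"
  have n: "0 < n" "p n = h" using LeastI_ex[OF ex] by (auto simp: n_def)
  have least: "\<not> (0 < m \<and> p m = h)" if "m < n" for m
    using that not_less_Least unfolding n_def by blast
  have d: "inj_on p {0..<n}"
  proof (rule linorder_inj_onI)
    fix i j assume ij: "i < j" "i \<in> {0..<n}" "j \<in> {0..<n}"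
    show "p i \<noteq> p j"
    proof
      assume "p i = p j"
      then have "p (j - i) = h" using period ij by simp
      moreover have "0 < j - i" "j - i < n" using ij by auto
      ultimately show False using least[of "j - i"] by simp
    qed
  qed auto
  show thesis
  proof (rule that[of "map p [0..<n]"])
    show "map p [0..<n] ! 0 = h" using n p0 by simp
    fix i assume "i < length (map p [0..<n])"
    then have i: "i < n" by simp
    show "a (t (map p [0..<n] ! i)) = map p [0..<n] ! (Suc i mod length (map p [0..<n]))"
    proof (cases "Suc i = n")
      case True
      then show ?thesis using i n p0 pS[of i] by simp
    next
      case False
      then have "Suc i < n" using i by simp
      then show ?thesis using i pS by simp
    qed
  qed (use n d pH in \<open>auto simp: distinct_map\<close>)
qed

lemma orbit_list_disjoint:
  fixes a t :: "'b \<Rightarrow> 'b"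
  assumes a: "\<And>x. x \<in> H \<Longrightarrow> a x \<in> H \<and> a x \<noteq> x \<and> a (a x) = x"
    and t: "\<And>x. x \<in> H \<Longrightarrow> t x \<in> H \<and> t x \<noteq> x \<and> t (t x) = x"
    and hs: "hs \<noteq> []" "set hs \<subseteq> H"
    and nxt: "\<And>i. i < length hs \<Longrightarrow> a (t (hs ! i)) = hs ! (Suc i mod length hs)"
  shows "set hs \<inter> t ` set hs = {}"
proof -
  define p where "p i = hs ! (i mod length hs)" for i
  have pS: "a (t (p i)) = p (Suc i)" for i
    using nxt[of "i mod length hs"] hs by (simp add: p_def mod_Suc_eq)
  have pH: "p i \<in> H" for i
    using hs by (simp add: p_def subset_iff)
  have *: "t (p i) \<noteq> p (i + m)" for i m
  proof (induction m arbitrary: i rule: less_induct)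
    case (less m)
    have "m = 0 \<or> m = 1 \<or> m = Suc (Suc (m - 2))" by arith
    then consider "m = 0" | "m = 1" | m' where "m = Suc (Suc m')" by blast
    then show ?case
    proof cases
      case 1 then show ?thesis using t pH by simp
    next
      case 2
      have "a (t (p i)) \<noteq> t (p i)" using a[of "t (p i)"] t[OF pH[of i]] by blast
      then show ?thesis using pS[of i] 2 by (metis Suc_eq_plus1)
    next
      case 3
      show ?thesis
      proof
        assume e: "t (p i) = p (i + m)"
        let ?q = "p (Suc i + m')"
        have "p (Suc i) = a (p (i + m))" using pS[of i] e by simp
        also have "\<dots> = a (a (t ?q))" using pS[of "Suc i + m'"] 3 by simp
        also have "\<dots> = t ?q" using a[of "t ?q"] t[OF pH] by blast
        finally have "t (p (Suc i)) = t (t ?q)" by (rule arg_cong)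
        also have "\<dots> = ?q" using t[OF pH] by blast
        finally have "t (p (Suc i)) = ?q" .
        then show False using less[of m' "Suc i"] 3 by simp
      qed
    qed
  qed
  show ?thesis
  proof (rule ccontr)
    assume "\<not> ?thesis"
    then obtain x y where "x \<in> set hs" "y \<in> set hs" "x = t y" by auto
    then obtain i j where ij: "i < length hs" "j < length hs" "hs ! i = t (hs ! j)"
      by (metis in_set_conv_nth)
    then have e: "p i = t (p j)" by (simp add: p_def)
    then have e': "p j = t (p i)" using t[OF pH[of j]] by simp
    show False
    proof (cases "i \<le> j")
      case True
      then show ?thesis using *[of i "j - i"] e'[symmetric] by simp
    next
      case False
      then show ?thesis using *[of j "i - j"] e[symmetric] by simp
    qed
  qed
qed

lemma orbit_list_component:
  fixes a t :: "'b \<Rightarrow> 'b"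
  assumes a: "\<And>x. x \<in> H \<Longrightarrow> a x \<in> H \<and> a x \<noteq> x \<and> a (a x) = x"
    and t: "\<And>x. x \<in> H \<Longrightarrow> t x \<in> H \<and> t x \<noteq> x \<and> t (t x) = x"
    and hs: "hs \<noteq> []" "set hs \<subseteq> H"
    and nxt: "\<And>i. i < length hs \<Longrightarrow> a (t (hs ! i)) = hs ! (Suc i mod length hs)"
    and R: "R = {(h, a h) | h. h \<in> H} \<union> {(h, t h) | h. h \<in> H}"
  shows "set hs \<union> t ` set hs = ((R \<union> R\<inverse>) \<inter> H \<times> H)\<^sup>* `` {hs ! 0}"
proof -
  let ?K = "set hs \<union> t ` set hs" and ?E = "(R \<union> R\<inverse>) \<inter> H \<times> H"
  define p where "p i = hs ! (i mod length hs)" for i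
  have pS: "a (t (p i)) = p (Suc i)" for i
    using nxt[of "i mod length hs"] hs by (simp add: p_def mod_Suc_eq)
  have pH: "p i \<in> H" and pm: "p i \<in> set hs" for i
    using hs by (simp_all add: p_def subset_iff)
  have setp: "\<exists>i. x = p i" if "x \<in> set hs" for x
    using that by (metis in_set_conv_nth mod_less p_def)
  have pper: "p (i + length hs) = p i" for i by (simp add: p_def)
  have E: "(x, a x) \<in> ?E" "(x, t x) \<in> ?E" if "x \<in> H" for x
    using that a[OF that] t[OF that] unfolding R by blast+
  have Eonly: "y = a x \<or> y = t x" if "(x, y) \<in> ?E" for x y
  proof -
    have "(x \<in> H \<and> (y = a x \<or> y = t x)) \<or> (y \<in> H \<and> (x = a y \<or> x = t y))"
      using that unfolding R by blast
    then show ?thesis using a[of y] t[of y] by metis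
  qed
  have ap: "a (p i) \<in> t ` set hs" for i
  proof -
    have "p i = p (Suc (i + length hs - 1))" using pper hs by (cases hs) auto
    then have "a (p i) = a (a (t (p (i + length hs - 1))))" using pS[of "i + length hs - 1"] by simp
    also have "\<dots> = t (p (i + length hs - 1))"
      using a[of "t (p (i + length hs - 1))"] t[OF pH] by blast
    finally show ?thesis using pm[of "i + length hs - 1"] by simp
  qed
  have closed: "a x \<in> ?K \<and> t x \<in> ?K" if "x \<in> ?K" for x
  proof -
    from that obtain i where "x = p i \<or> x = t (p i)" using setp by blast
    then show ?thesis
      using ap[of i] pS[of i] pm[of i] pm[of "Suc i"] t[OF pH[of i]] by auto
  qed
  have reach: "(p 0, p i) \<in> ?E\<^sup>*" for i
  proof (induction i)
    case (Suc i)
    have "(p i, t (p i)) \<in> ?E" "(t (p i), p (Suc i)) \<in> ?E"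
      using E(2)[OF pH[of i]] E(1)[of "t (p i)"] pS[of i] t[OF pH[of i]] by auto
    then show ?case using Suc.IH by (meson rtrancl.rtrancl_into_rtrancl)
  qed simp
  have p0: "p 0 = hs ! 0" by (simp add: p_def)
  show ?thesis
  proof
    show "?K \<subseteq> ?E\<^sup>* `` {hs ! 0}"
    proof
      fix x assume "x \<in> ?K"
      then obtain i where "x = p i \<or> x = t (p i)" using setp by blast
      moreover have "(p 0, t (p i)) \<in> ?E\<^sup>*"
        
        using reach[of i] E(2)[OF pH[of i]] by (rule rtrancl.rtrancl_into_rtrancl)
      ultimately show "x \<in> ?E\<^sup>* `` {hs ! 0}" using reach[of i] p0 by auto
    qed
    show "?E\<^sup>* `` {hs ! 0} \<subseteq> ?K"
    proof
      fix x assume "x \<in> ?E\<^sup>* `` {hs ! 0}"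
      then have "(hs ! 0, x) \<in> ?E\<^sup>*" by simp
      then show "x \<in> ?K"
      proof (induction rule: rtrancl_induct)
        case base then show ?case using pm[of 0] p0 by simp
      next
        case (step y z)
        show ?case using Eonly[OF step(2)] closed[OF step(3)] by blast
      qed
    qed
  qed
qed

lemma through_involution:
  assumes "h \<in> half_edges L"
  shows "through L s h \<in> half_edges L \<and> through L s h \<noteq> h \<and> through L s (through L s h) = h"
proof -
  obtain c i where h: "h = (c, i)" by (cases h)
  then have "c \<in> crossings L" "i \<in> {0, 1, 2, 3}"
    using assms by (auto simp: half_edges_def)
  then show ?thesis
    by (cases "s c") (auto simp: h half_edges_def through_def strand_start_def)
qed

lemma state_ribbon_graph_exists:
  assumes L: "virtual_link_diagram L"
  shows "\<exists>G. state_ribbon_graph L s G"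
proof -
  let ?H = "half_edges L" and ?a = "across L" and ?t = "through L s"
  let ?R = "{(h, ?a h) | h. h \<in> ?H} \<union> {(h, ?t h) | h. h \<in> ?H}"
  let ?E = "((?R \<union> ?R\<inverse>) \<inter> ?H \<times> ?H)\<^sup>*"
  have a: "?a h \<in> ?H \<and> ?a h \<noteq> h \<and> ?a (?a h) = h" if "h \<in> ?H" for h
    using L that by (auto simp: virtual_link_diagram_def)
  note t = through_involution[of _ L s]
  have fin: "finite ?H" using L by (simp add: virtual_link_diagram_def half_edges_def)
  have sc: "state_circles L s = (\<lambda>h. ?E `` {h}) ` ?H"
    by (auto simp: state_circles_def graph_components_def quotient_def)
  have disj: "X = Y" if "X \<in> state_circles L s" "Y \<in> state_circles L s" "x \<in> X" "x \<in> Y" for X Y x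
  proof -
    have "sym ?E" by (intro sym_rtrancl symI) auto
    then have "equiv UNIV ?E" by (intro equivI refl_rtrancl trans_rtrancl) auto
    then show ?thesis using that unfolding sc
      by (smt (verit) Image_singleton_iff equiv_class_eq imageE)
  qed
  have "\<exists>hs. traversal L s hs \<and> traversed_circle L s hs = X" if X: "X \<in> state_circles L s" for X
  proof -
    obtain h where h: "h \<in> ?H" "X = ?E `` {h}" using X sc by blast
    obtain hs where hs: "hs \<noteq> []" "distinct hs" "set hs \<subseteq> ?H" "hs ! 0 = h"
      "\<And>i. i < length hs \<Longrightarrow> ?a (?t (hs ! i)) = hs ! (Suc i mod length hs)"
      by (rule orbit_list_exists[OF fin h(1), of ?a ?t]) (use a t in auto)
    have "set hs \<union> ?t ` set hs = X"
      using orbit_list_component[OF a t hs(1,3,5) refl] hs(4) h(2) by simp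
    then show ?thesis using hs by (auto simp: traversal_def traversed_circle_def)
  qed
  then obtain g where g: "\<And>X. X \<in> state_circles L s \<Longrightarrow> traversal L s (g X) \<and> traversed_circle L s (g X) = X"
    by metis
  have "finite (state_circles L s)" using fin sc by simp
  then obtain Xs where Xs: "set Xs = state_circles L s" "distinct Xs"
    using finite_distinct_list by blast
  define hss where "hss = map g Xs"
  have m: "map (traversed_circle L s) hss = Xs"
    unfolding hss_def using g Xs by (auto intro!: map_idI)
  have trav: "\<forall>hs \<in> set hss. traversal L s hs" using g Xs by (auto simp: hss_def)
  have im: "traversed_circle L s ` set hss = state_circles L s"
    using m Xs by (metis list.set_map)
  have mem: "traversed_circle L s hs \<in> state_circles L s" if "hs \<in> set hss" for hs
    using that im by blast
  have same: "hs = hs'" if "hs \<in> set hss" "hs' \<in> set hss"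
      "x \<in> traversed_circle L s hs" "x \<in> traversed_circle L s hs'" for hs hs' x
  proof -
    have "traversed_circle L s hs = traversed_circle L s hs'" using disj mem that by blast
    moreover have "inj_on (traversed_circle L s) (set hss)" using m Xs by (metis distinct_map)
    ultimately show ?thesis using that by (meson inj_onD)
  qed
  have dist: "distinct (concat hss)"
  proof (rule distinct_concat)
    show "distinct hss" using m Xs by (metis distinct_map)
    show "distinct ys" if "ys \<in> set hss" for ys using trav that by (auto simp: traversal_def)
    show "set ys \<inter> set zs = {}" if "ys \<in> set hss" "zs \<in> set hss" "ys \<noteq> zs" for ys zs
      using same that unfolding traversed_circle_def by blast
  qed
  let ?S = "set (concat hss)"
  have SH: "?S \<subseteq> ?H" using trav by (auto simp: traversal_def)
  have cover: "?S \<union> ?t ` ?S = ?H"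
  proof
    show "?S \<union> ?t ` ?S \<subseteq> ?H" using SH t by blast
    show "?H \<subseteq> ?S \<union> ?t ` ?S"
    proof
      fix h assume "h \<in> ?H"
      then have "h \<in> \<Union> (state_circles L s)" unfolding sc by blast
      then show "h \<in> ?S \<union> ?t ` ?S" unfolding im[symmetric] traversed_circle_def by auto
    qed
  qed
  have disjoint: "?S \<inter> ?t ` ?S = {}"
  proof (rule ccontr)
    assume "\<not> ?thesis"
    then obtain hs hs' x y where x: "hs \<in> set hss" "hs' \<in> set hss" "x \<in> set hs" "y \<in> set hs'" "x = ?t y"
      by auto
    then have "hs = hs'" using same[of hs hs' x] by (auto simp: traversed_circle_def)
    moreover have "set hs \<inter> ?t ` set hs = {}"
      using orbit_list_disjoint[OF a t, of hs] trav x(1) by (auto simp: traversal_def)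
    ultimately show False using x by blast
  qed
  define G where "G = \<lparr>circles = map (arrow_word L s) hss @ replicate (loops L) [],
    edge_sign = (\<lambda>c. case s c of Split_A \<Rightarrow> 1 | Split_B \<Rightarrow> -1)\<rparr>"
  have word: "map fst (concat (map (arrow_word L s) xs)) = filter (\<lambda>c. c \<in> classical L) (map fst (concat xs))" for xs
    by (induction xs) (auto simp: arrow_word_def filter_map o_def case_prod_unfold)
  have repl: "concat (replicate n []) = []" for n by (induction n) auto
  have lab: "map fst (concat (circles G)) = filter (\<lambda>c. c \<in> classical L) (map fst (concat hss))"
    using word[of hss] by (simp add: G_def repl)
  have "count_list (map fst (concat (circles G))) c = 2" if c: "c \<in> edges G" for c
  proof -
    have "c \<in> set (map fst (concat (circles G)))" using c by (simp add: edges_def)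
    then have cc: "c \<in> classical L" unfolding lab by simp
    let ?Sc = "{h \<in> ?S. fst h = c}"
    have fc: "fst (?t h) = fst h" for h by (simp add: through_def case_prod_beta)
    have "?Sc \<union> ?t ` ?Sc = {c} \<times> {..<4}"
    proof -
      have "?Sc \<union> ?t ` ?Sc = {h \<in> ?S \<union> ?t ` ?S. fst h = c}" using fc by auto
      also have "\<dots> = {c} \<times> {..<4}"
        unfolding cover using cc by (auto simp: half_edges_def classical_def)
      finally show ?thesis .
    qed
    then have "4 = card (?Sc \<union> ?t ` ?Sc)" by simp
    also have "\<dots> = card ?Sc + card (?t ` ?Sc)"
      by (rule card_Un_disjoint) (use disjoint in auto)
    also have "card (?t ` ?Sc) = card ?Sc"
      by (rule card_image, rule inj_onI) (use t SH in \<open>metis (no_types, lifting) mem_Collect_eq subsetD\<close>)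
    finally have two: "card ?Sc = 2" by simp
    have "count_list (map fst (concat (circles G))) c = length (filter (\<lambda>h. fst h = c) (concat hss))"
      unfolding lab using cc
      by (simp add: count_list_eq_length_filter filter_map o_def) (metis (mono_tags, lifting))
    also have "\<dots> = card (set (filter (\<lambda>h. fst h = c) (concat hss)))"
      using dist by (metis distinct_card distinct_filter)
    also have "\<dots> = 2" using two by simp
    finally show ?thesis .
  qed
  then have "signed_ribbon_graph G"
    by (auto simp: signed_ribbon_graph_def G_def split: splitting.split)
  moreover have "circles G = map (arrow_word L s) hss @ replicate (loops L) []"
    "\<forall>c \<in> classical L. edge_sign G c = (case s c of Split_A \<Rightarrow> 1 | Split_B \<Rightarrow> -1)"
    by (simp_all add: G_def)
  ultimately have "state_ribbon_graph L s G"
    unfolding state_ribbon_graph_def using trav im m Xs by metis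
  then show ?thesis ..
qed

end

theory Submission
  imports Defs
begin

text \<open>
  A state is determined by the set \<open>F\<close> of classical crossings at which it differs from \<open>s\<close>, that is,
  by a spanning subgraph of the ribbon graph of \<open>s\<close>. At a crossing in \<open>F\<close> the new strands run along
  the free sides of the band; at the other crossings they are the old strands, which is also what is
  left of the circles after the band is removed. So the state circles of the new state are the
  boundary components of the subgraph. The bracket and the polynomial then agree term by term,
  because \<open>x y z\<^sup>2 = 1\<close>.
\<close>

section \<open>Connected components\<close>

text \<open>The two graphs to be compared have different vertex sets. The new state circles are
  components of a graph on all half-edges, those at virtual crossings included, while the boundary
  of the subgraph is built from the ends of surviving arrows only. So there is no bijection of
  vertices, only a pair of maps that are inverse to each other up to linkedness, which is enough to
  count components. These maps cannot see a circle that has lost all its arrows: it has half-edges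
  but no arrow ends, and \<open>num_boundary\<close> counts it in a separate term. Hence the
  half-edges are divided into those on circles with a surviving arrow and the rest, a division that
  the new strands respect. A further difficulty is that each circle comes with an arbitrary
  direction. The predicate \<open>start\<close> removes it: the tail of an arrow is the start of its
  strand, whichever way the circle runs.\<close>

definition linked :: "'a set \<Rightarrow> ('a \<times> 'a) set \<Rightarrow> ('a \<times> 'a) set" where
  "linked S R = ((R \<union> R\<inverse>) \<inter> S \<times> S)\<^sup>*"

lemma graph_components_linked: "graph_components S R = (\<lambda>x. linked S R `` {x}) ` S"
  by (auto simp: graph_components_def linked_def quotient_def)

lemma linked_refl [simp]: "(x, x) \<in> linked S R"
  by (simp add: linked_def)

lemma linked_sym: "(x, y) \<in> linked S R \<Longrightarrow> (y, x) \<in> linked S R"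
proof -
  have "sym (linked S R)"
    unfolding linked_def by (intro sym_rtrancl symI) auto
  then show "(x, y) \<in> linked S R \<Longrightarrow> (y, x) \<in> linked S R" by (rule symD)
qed

lemma linked_trans [trans]:
  "(x, y) \<in> linked S R \<Longrightarrow> (y, z) \<in> linked S R \<Longrightarrow> (x, z) \<in> linked S R"
  unfolding linked_def by (rule rtrancl_trans)

lemma linked_edge: "(x, y) \<in> R \<Longrightarrow> x \<in> S \<Longrightarrow> y \<in> S \<Longrightarrow> (x, y) \<in> linked S R"
  unfolding linked_def by auto

lemma linked_in: "(x, y) \<in> linked S R \<Longrightarrow> x \<in> S \<Longrightarrow> y \<in> S"
  unfolding linked_def by (induction rule: rtrancl_induct) auto

lemma linked_class_eq: "(x, y) \<in> linked S R \<Longrightarrow> linked S R `` {x} = linked S R `` {y}"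
  using linked_sym linked_trans by fast

lemma linked_map:
  assumes f: "\<And>v v'. (v, v') \<in> R \<Longrightarrow> v \<in> V \<Longrightarrow> v' \<in> V \<Longrightarrow> (f v, f v') \<in> linked W Q"
    and "(x, y) \<in> linked V R"
  shows "(f x, f y) \<in> linked W Q"
  using assms(2) unfolding linked_def[of V R]
proof (induction rule: rtrancl_induct)
  case (step y z)
  then have "(f y, f z) \<in> linked W Q" using f linked_sym by fast
  with step.IH show ?case by (rule linked_trans)
qed simp

text \<open>Both maps send linked vertices to linked vertices, so they act on components; the last
  two hypotheses make these actions inverse to each other. Vertices need not correspond one to
  one.\<close>

lemma card_graph_components_eq:
  assumes f: "\<And>v. v \<in> V \<Longrightarrow> f v \<in> W" and g: "\<And>w. w \<in> W \<Longrightarrow> g w \<in> V"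
    and fR: "\<And>v v'. (v, v') \<in> R \<Longrightarrow> v \<in> V \<Longrightarrow> v' \<in> V \<Longrightarrow> (f v, f v') \<in> linked W Q"
    and gQ: "\<And>w w'. (w, w') \<in> Q \<Longrightarrow> w \<in> W \<Longrightarrow> w' \<in> W \<Longrightarrow> (g w, g w') \<in> linked V R"
    and gf: "\<And>v. v \<in> V \<Longrightarrow> (v, g (f v)) \<in> linked V R"
    and fg: "\<And>w. w \<in> W \<Longrightarrow> (w, f (g w)) \<in> linked W Q"
  shows "card (graph_components V R) = card (graph_components W Q)"
proof -
  have F: "linked W Q `` (f ` linked V R `` {v}) = linked W Q `` {f v}" for v
    using linked_map[of R V f W Q v, OF fR] by (auto intro: linked_trans)
  have G: "linked V R `` (g ` linked W Q `` {w}) = linked V R `` {g w}" for w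
    using linked_map[of Q W g V R w, OF gQ] by (auto intro: linked_trans)
  \<comment> \<open>The image of a class is in general only part of a class, hence the saturation by
    \<open>linked W Q\<close>.\<close>
  have "bij_betw (\<lambda>X. linked W Q `` (f ` X)) (graph_components V R) (graph_components W Q)"
    unfolding graph_components_linked
  proof (rule bij_betw_byWitness[where f' = "\<lambda>X. linked V R `` (g ` X)"])
    show "\<forall>X \<in> (\<lambda>x. linked V R `` {x}) ` V. linked V R `` (g ` linked W Q `` (f ` X)) = X"
      using linked_class_eq[OF gf] by (auto simp only: F G ball_simps)
    show "\<forall>X \<in> (\<lambda>x. linked W Q `` {x}) ` W. linked W Q `` (f ` linked V R `` (g ` X)) = X"
      using linked_class_eq[OF fg] by (auto simp only: F G ball_simps)
  qed (use f g in \<open>auto simp only: F G image_subset_iff image_eqI\<close>)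
  then show ?thesis by (rule bij_betw_same_card)
qed

text \<open>A path from \<open>x\<close> cannot leave \<open>T\<close>, because no edge joins
  \<open>T\<close> to its complement in \<open>S\<close>; so all its edges survive the restriction
  to \<open>T\<close>.\<close>

lemma linked_subset:
  assumes "T \<subseteq> S" and closed: "\<And>x y. (x, y) \<in> R \<Longrightarrow> x \<in> S \<Longrightarrow> y \<in> S \<Longrightarrow> x \<in> T \<longleftrightarrow> y \<in> T"
    and "x \<in> T"
  shows "linked S R `` {x} = linked T R `` {x}"
proof -
  have "(x, y) \<in> linked T R \<and> y \<in> T" if "(x, y) \<in> linked S R" for y
    using that unfolding linked_def[of S]
  proof (induction rule: rtrancl_induct)
    case (step y z)
    then have "z \<in> T" using closed by blast
    then have "(y, z) \<in> (R \<union> R\<inverse>) \<inter> T \<times> T" using step by blast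
    with step.IH \<open>z \<in> T\<close> show ?case
      unfolding linked_def by (auto intro: rtrancl.rtrancl_into_rtrancl)
  qed (use \<open>x \<in> T\<close> in simp)
  moreover have "(x, y) \<in> linked S R" if "(x, y) \<in> linked T R" for y
    by (rule linked_map[of R T "\<lambda>x. x", OF linked_edge that]) (use \<open>T \<subseteq> S\<close> in auto)
  ultimately show ?thesis by blast
qed

lemma card_graph_components_split:
  assumes "finite S" "T \<subseteq> S"
    and closed: "\<And>x y. (x, y) \<in> R \<Longrightarrow> x \<in> S \<Longrightarrow> y \<in> S \<Longrightarrow> x \<in> T \<longleftrightarrow> y \<in> T"
  shows "card (graph_components S R)
    = card (graph_components T R) + card (graph_components (S - T) R)"
proof -
  have T: "linked S R `` {x} = linked T R `` {x}" if "x \<in> T" for x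
    using linked_subset[OF \<open>T \<subseteq> S\<close> closed that] .
  have D: "linked S R `` {x} = linked (S - T) R `` {x}" if "x \<in> S - T" for x
    by (rule linked_subset) (use that closed in auto)
  have "graph_components S R
    = (\<lambda>x. linked S R `` {x}) ` T \<union> (\<lambda>x. linked S R `` {x}) ` (S - T)"
    unfolding graph_components_linked using \<open>T \<subseteq> S\<close> by blast
  also have "\<dots> = graph_components T R \<union> graph_components (S - T) R"
    unfolding graph_components_linked using T D by (intro arg_cong2[of _ _ _ _ "(\<union>)"] image_cong) auto
  finally have "graph_components S R = graph_components T R \<union> graph_components (S - T) R" .
  moreover have "graph_components T R \<inter> graph_components (S - T) R = {}"
  proof -
    have "\<Union> (graph_components T R) \<subseteq> T" "\<Union> (graph_components (S - T) R) \<subseteq> S - T"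
      unfolding graph_components_linked using linked_in by fast+
    moreover have "{} \<notin> graph_components T R"
      unfolding graph_components_linked using linked_refl by fast
    ultimately have "X = {}" if "X \<in> graph_components T R" "X \<in> graph_components (S - T) R" for X
      using that by fast
    with \<open>{} \<notin> graph_components T R\<close> show ?thesis by auto
  qed
  moreover have "finite (graph_components T R)" "finite (graph_components (S - T) R)"
    using assms(1,2) finite_subset by (auto simp: graph_components_linked)
  ultimately show ?thesis by (simp add: card_Un_disjoint)
qed

section \<open>Positions in filtered lists\<close>

lemma length_filter_take_Suc:
  "p < length xs \<Longrightarrow>
    length (filter P (take (Suc p) xs)) = length (filter P (take p xs)) + (if P (xs ! p) then 1 else 0)"
  by (simp add: take_Suc_conv_app_nth)

lemma length_filter_take_le: "length (filter P (take p xs)) \<le> length (filter P xs)"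
  using arg_cong[OF append_take_drop_id[of p xs], of "\<lambda>ys. length (filter P ys)"]
  by (simp del: append_take_drop_id)

lemma filter_nth_take:
  assumes "p < length xs" "P (xs ! p)"
  shows "length (filter P (take p xs)) < length (filter P xs)"
    and "filter P xs ! length (filter P (take p xs)) = xs ! p"
proof -
  have "filter P xs = filter P (take p xs) @ xs ! p # filter P (drop (Suc p) xs)"
    using arg_cong[OF id_take_nth_drop[OF assms(1)], of "filter P"] assms(2) by simp
  then show "length (filter P (take p xs)) < length (filter P xs)"
    and "filter P xs ! length (filter P (take p xs)) = xs ! p"
    by (simp_all only: nth_append_length length_append list.size)
qed

text \<open>Surjectivity of the passage from surviving positions to indices of the filtered list,
  which \<open>filter_nth_take\<close> describes in the other direction.\<close>

lemma filter_nth_position: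
  assumes "j < length (filter P xs)"
  obtains p where "p < length xs" "P (xs ! p)" "length (filter P (take p xs)) = j"
proof -
  have "\<exists>p < length xs. P (xs ! p) \<and> length (filter P (take p xs)) = j"
    using assms
  proof (induction xs arbitrary: j)
    case (Cons x xs)
    show ?case
    proof (cases "P x \<and> j = 0")
      case True
      then show ?thesis by (intro exI[of _ 0]) simp
    next
      case False
      define j' where "j' = j - (if P x then 1 else 0)"
      have "j' < length (filter P xs)" using Cons.prems False by (auto simp: j'_def split: if_splits)
      then obtain p where "p < length xs" "P (xs ! p)" "length (filter P (take p xs)) = j'"
        using Cons.IH by blast
      then show ?thesis using False by (intro exI[of _ "Suc p"]) (auto simp: j'_def)
    qed
  qed simp
  then show thesis using that by blast
qed

section \<open>Traversals of the state circles\<close>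

text \<open>The list \<open>hss\<close> is the witness inside \<open>state_ribbon_graph\<close>. As
  nothing more is fixed about it, the results hold for every order, starting point and direction of
  the circles.\<close>

locale state_traversals =
  fixes L :: "'c virtual_link_diagram" and s :: "'c \<Rightarrow> splitting" and hss :: "('c \<times> nat) list list"
  assumes diagram: "virtual_link_diagram L"
    and traversals: "hs \<in> set hss \<Longrightarrow> traversal L s hs"
    and distinct_circles: "distinct (map (traversed_circle L s) hss)"
    and all_circles: "traversed_circle L s ` set hss = state_circles L s"
begin

abbreviation "thr \<equiv> through L s"

abbreviation "letter i p \<equiv> hss ! i ! p"

lemma finite_half_edges: "finite (half_edges L)"
  using diagram by (simp add: virtual_link_diagram_def half_edges_def)

lemma across_half_edges:
  "h \<in> half_edges L \<Longrightarrow> across L h \<in> half_edges L \<and> across L h \<noteq> h \<and> across L (across L h) = h"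
  using diagram by (simp add: virtual_link_diagram_def)

lemmas through_half_edges = through_involution[of _ L s]

lemma fst_through [simp]: "fst (through L s' h) = fst h"
  by (simp add: through_def case_prod_beta)

lemma letter_half_edge: "i < length hss \<Longrightarrow> p < length (hss ! i) \<Longrightarrow> letter i p \<in> half_edges L"
  using traversals[of "hss ! i"] by (auto simp: traversal_def)

lemma through_letter_half_edge:
  "i < length hss \<Longrightarrow> p < length (hss ! i) \<Longrightarrow> thr (letter i p) \<in> half_edges L"
  using through_half_edges letter_half_edge by blast

lemma through_through_letter:
  "i < length hss \<Longrightarrow> p < length (hss ! i) \<Longrightarrow> thr (thr (letter i p)) = letter i p"
  using through_half_edges letter_half_edge by blast

lemma across_through_letter:
  "i < length hss \<Longrightarrow> p < length (hss ! i) \<Longrightarrow>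
    across L (thr (letter i p)) = letter i (Suc p mod length (hss ! i))"
  using traversals[of "hss ! i"] by (auto simp: traversal_def)

lemma across_letter:
  assumes "i < length hss" "p < length (hss ! i)"
  shows "across L (letter i (Suc p mod length (hss ! i))) = thr (letter i p)"
  using across_through_letter[OF assms] across_half_edges[of "thr (letter i p)"]
    through_half_edges[OF letter_half_edge[OF assms]] by simp

lemma circle_unique:
  assumes i: "i < length hss" and j: "j < length hss"
    and x: "x \<in> traversed_circle L s (hss ! i)" "x \<in> traversed_circle L s (hss ! j)"
  shows "i = j"
proof -
  obtain R where R: "state_circles L s = (\<lambda>h. linked (half_edges L) R `` {h}) ` half_edges L"
    by (simp add: state_circles_def graph_components_linked)
  have "X = linked (half_edges L) R `` {x}" if "X \<in> state_circles L s" "x \<in> X" for X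
    using that linked_class_eq unfolding R by fast
  moreover have "traversed_circle L s (hss ! i) \<in> state_circles L s"
    "traversed_circle L s (hss ! j) \<in> state_circles L s"
    using i j all_circles by auto
  ultimately have "traversed_circle L s (hss ! i) = traversed_circle L s (hss ! j)"
    using x by metis
  then show ?thesis
    using distinct_circles i j by (simp add: distinct_conv_nth) blast
qed

text \<open>Passage \<open>p\<close> of circle \<open>i\<close> through a crossing uses two
  half-edges, the letter by which it enters and the partner by which it leaves; both get the same
  address.\<close>

definition lies_at :: "nat \<times> nat \<Rightarrow> 'c \<times> nat \<Rightarrow> bool" where
  "lies_at = (\<lambda>(i, p) h. i < length hss \<and> p < length (hss ! i) \<and> (h = letter i p \<or> h = thr (letter i p)))"

text \<open>A circle that entered and left by the same half-edge would fold back on itself, and at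
  the fold one of the fixed-point-free involutions \<open>across L\<close> and \<open>thr\<close>
  would fix a half-edge.\<close>

lemma letter_neq_through:
  assumes "i < length hss" "p < length (hss ! i)" "p' < length (hss ! i)"
  shows "letter i p \<noteq> thr (letter i p')"
proof -
  have "set (hss ! i) \<inter> thr ` set (hss ! i) = {}"
    by (rule orbit_list_disjoint[OF across_half_edges through_half_edges])
      (use assms(1) traversals[of "hss ! i"] in \<open>auto simp: traversal_def\<close>)
  moreover have "letter i p \<in> set (hss ! i)" "thr (letter i p') \<in> thr ` set (hss ! i)"
    using assms by simp_all
  ultimately show ?thesis by (metis IntI empty_iff)
qed

lemma lies_at_unique:
  assumes "lies_at (i, p) h" "lies_at (j, q) h"
  shows "i = j" "p = q"
proof -
  show "i = j"
    using assms by (intro circle_unique[of i j h])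
      (simp_all add: lies_at_def traversed_circle_def, (metis UnI1 UnI2 imageI nth_mem)+)
  then have ip: "i < length hss" "p < length (hss ! i)" "q < length (hss ! i)"
    "h = letter i p \<or> h = thr (letter i p)" "h = letter i q \<or> h = thr (letter i q)"
    using assms by (auto simp: lies_at_def)
  have "letter i p = letter i q"
    using ip letter_neq_through through_through_letter by metis
  then show "p = q"
    using ip traversals[of "hss ! i"] by (auto simp: traversal_def nth_eq_iff_index_eq)
qed

lemma ex_lies_at:
  assumes "h \<in> half_edges L"
  obtains i p where "lies_at (i, p) h"
proof -
  have "h \<in> \<Union> (state_circles L s)"
    using assms linked_refl unfolding state_circles_def graph_components_linked by fast
  then obtain hs where "hs \<in> set hss" "h \<in> traversed_circle L s hs"
    unfolding all_circles[symmetric] by blast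
  then obtain i x where i: "i < length hss" "x \<in> set (hss ! i)" "h = x \<or> h = thr x"
    unfolding traversed_circle_def in_set_conv_nth[of hs] by blast
  then obtain p where "p < length (hss ! i)" "x = letter i p"
    by (metis in_set_conv_nth)
  then show thesis
    using i that[of i p] by (simp add: lies_at_def)
qed

lemma lies_at_letter: "i < length hss \<Longrightarrow> p < length (hss ! i) \<Longrightarrow> lies_at (i, p) (letter i p)"
  "i < length hss \<Longrightarrow> p < length (hss ! i) \<Longrightarrow> lies_at (i, p) (thr (letter i p))"
  by (simp_all add: lies_at_def)

lemma edges_state_graph:
  assumes "circles G = map (arrow_word L s) hss @ replicate (loops L) []"
  shows "edges G = classical L"
proof -
  have "edges G = (\<Union>w \<in> set (circles G). fst ` set w)"
    by (simp add: edges_def image_UN)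
  also have "\<dots> = (\<Union>hs \<in> set hss. fst ` set (arrow_word L s hs))"
    unfolding assms by (simp add: set_replicate_conv_if)
  also have "\<dots> = (\<Union>hs \<in> set hss. {c \<in> classical L. c \<in> fst ` set hs})"
    by (force simp: arrow_word_def)
  also have "\<dots> = classical L"
  proof -
    have "\<exists>hs \<in> set hss. c \<in> fst ` set hs" if "c \<in> classical L" for c
    proof -
      \<comment> \<open>Any half-edge at \<open>c\<close> would do: \<open>thr\<close> keeps the
        crossing, so the letter of the passage found is labelled \<open>c\<close> even if this
        half-edge is the leaving one.\<close>
      have "(c, 0) \<in> half_edges L" using that by (simp add: half_edges_def classical_def)
      then obtain i p where ip: "lies_at (i, p) (c, 0)" using ex_lies_at by blast
      then have i: "i < length hss" "p < length (hss ! i)"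
        and "(c, 0) = letter i p \<or> (c, 0) = thr (letter i p)"
        by (simp_all add: lies_at_def)
      then have "fst (letter i p) = c"
        by (metis fst_conv fst_through)
      then show ?thesis using i by (metis imageI nth_mem)
    qed
    then show ?thesis by blast
  qed
  finally show ?thesis .
qed

definition position :: "'c \<times> nat \<Rightarrow> nat \<times> nat" where
  "position h = (SOME ip. lies_at ip h)"

lemma position_eq: "lies_at (i, p) h \<Longrightarrow> position h = (i, p)"
  unfolding position_def by (rule some_equality) (auto dest: lies_at_unique)

lemmas position_letter = lies_at_letter[THEN position_eq]

end

section \<open>State circles as boundary components\<close>

text \<open>The restriction to classical crossings makes the result extensional, as the members of
  \<open>states L\<close> are.\<close>

definition resplit :: "'c virtual_link_diagram \<Rightarrow> ('c \<Rightarrow> splitting) \<Rightarrow> 'c set \<Rightarrow> 'c \<Rightarrow> splitting" where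
  "resplit L s F = (\<lambda>c \<in> classical L.
     if c \<in> F then (case s c of Split_A \<Rightarrow> Split_B | Split_B \<Rightarrow> Split_A) else s c)"

lemma resplit_iff:
  "c \<in> classical L \<Longrightarrow> resplit L s F c = m \<longleftrightarrow> (if c \<in> F then s c \<noteq> m else s c = m)"
  by (cases "s c"; cases m) (simp_all add: resplit_def)

lemma bij_betw_resplit:
  assumes "s \<in> states L"
  shows "bij_betw (resplit L s) (Pow (classical L)) (states L)"
proof (rule bij_betw_byWitness[where f' = "\<lambda>s'. {c \<in> classical L. s' c \<noteq> s c}"])
  show "\<forall>F \<in> Pow (classical L). {c \<in> classical L. resplit L s F c \<noteq> s c} = F"
    by (auto simp: resplit_iff split: if_splits)
  show "\<forall>s' \<in> states L. resplit L s {c \<in> classical L. s' c \<noteq> s c} = s'"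
  proof (intro ballI ext)
    fix s' c assume "s' \<in> states L"
    then show "resplit L s {c \<in> classical L. s' c \<noteq> s c} c = s' c"
      by (cases "c \<in> classical L") (auto simp: resplit_iff, auto simp: resplit_def states_def PiE_def extensional_def)
  qed
qed (auto simp: resplit_def states_def)

locale resplit_state = state_traversals L s hss
  for L :: "'c virtual_link_diagram" and s hss +
  fixes F :: "'c set"
  assumes F: "F \<subseteq> classical L"
begin

abbreviation "thr' \<equiv> through L (resplit L s F)"

lemmas resplit_half_edges = through_involution[of _ L "resplit L s F"]

definition in_F :: "'c \<times> nat \<Rightarrow> bool" where "in_F h \<longleftrightarrow> fst h \<in> F"

lemma in_F_through [simp]: "in_F (through L s' h) = in_F h"
  by (simp add: in_F_def)

lemma resplit_eq: "h \<in> half_edges L \<Longrightarrow> \<not> in_F h \<Longrightarrow> thr' h = thr h"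
  by (auto simp: half_edges_def in_F_def through_def resplit_def classical_def strand_start_def)

text \<open>This depends on the half-edge alone, whereas the Boolean of an arrow also depends on the
  direction of its circle. The starts are the tails of the arrows.\<close>

definition start :: "'c \<times> nat \<Rightarrow> bool" where
  "start h \<longleftrightarrow> strand_start (s (fst h)) (snd h)"

text \<open>Around a classical crossing \<open>start\<close> alternates, and each splitting joins a
  half-edge to one of its two cyclic neighbours. So the two half-edges of the opposite kind are
  these neighbours, one reached by the old strand and one by the new.\<close>

lemma start_through:
  assumes "h \<in> half_edges L" "in_F h"
  shows "start (thr h) \<longleftrightarrow> \<not> start h" "start (thr' h) \<longleftrightarrow> \<not> start h"
    "w \<in> half_edges L \<Longrightarrow> fst w = fst h \<Longrightarrow> start w \<noteq> start h \<Longrightarrow> w = thr h \<or> w = thr' h"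
    "thr' h \<noteq> thr h"
proof -
  obtain c i where h: "h = (c, i)" by (cases h)
  then have c: "c \<in> F" "c \<in> classical L" "c \<notin> virtual L" and i: "i \<in> {0, 1, 2, 3}"
    using assms F by (auto simp: half_edges_def in_F_def classical_def)
  show "start (thr h) \<longleftrightarrow> \<not> start h" "start (thr' h) \<longleftrightarrow> \<not> start h" "thr' h \<noteq> thr h"
    using i c by (cases "s c"; auto simp: h start_def through_def resplit_def strand_start_def)+
  assume "w \<in> half_edges L" "fst w = fst h" "start w \<noteq> start h"
  moreover from this obtain j where "w = (c, j)" "j < 4"
    by (cases w) (auto simp: half_edges_def h)
  moreover from \<open>j < 4\<close> have "j \<in> {0, 1, 2, 3}" by auto
  ultimately show "w = thr h \<or> w = thr' h"
    using i c by (cases "s c"; auto simp: h start_def through_def resplit_def strand_start_def)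
qed

section \<open>Surviving letters and their ranks\<close>

definition word :: "nat \<Rightarrow> ('c \<times> nat) list" where
  "word i = filter in_F (hss ! i)"

text \<open>
  The index in \<open>word i\<close> of the first surviving letter at position \<open>p\<close> or later; if there is none, it is
  the length of \<open>word i\<close>, which stands cyclically for the index 0.
\<close>

definition rank :: "nat \<Rightarrow> nat \<Rightarrow> nat" where
  "rank i p = length (filter in_F (take p (hss ! i)))"

lemma rank_0 [simp]: "rank i 0 = 0"
  by (simp add: rank_def)

lemma rank_length [simp]: "rank i (length (hss ! i)) = length (word i)"
  by (simp add: rank_def word_def)

lemma rank_Suc:
  "p < length (hss ! i) \<Longrightarrow> rank i (Suc p) = rank i p + (if in_F (letter i p) then 1 else 0)"
  by (simp add: rank_def length_filter_take_Suc)

text \<open>After the last position the left side restarts at rank 0 while the count on the right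
  has reached \<open>length (word i)\<close>; hence the reduction modulo that length.\<close>

lemma rank_Suc_mod:
  assumes "p < length (hss ! i)"
  shows "rank i (Suc p mod length (hss ! i)) mod length (word i)
    = (rank i p + (if in_F (letter i p) then 1 else 0)) mod length (word i)"
proof (cases "Suc p = length (hss ! i)")
  case True
  then show ?thesis using rank_Suc[OF assms] by simp
next
  case False
  then show ?thesis using rank_Suc[OF assms] assms by simp
qed

lemma rank_le: "rank i p \<le> length (word i)"
  by (simp add: rank_def word_def length_filter_take_le)

lemma word_rank:
  "p < length (hss ! i) \<Longrightarrow> in_F (letter i p) \<Longrightarrow>
    rank i p < length (word i) \<and> word i ! rank i p = letter i p"
  unfolding rank_def word_def by (simp add: filter_nth_take)

lemma word_position:
  assumes "j < length (word i)"
  obtains p where "p < length (hss ! i)" "in_F (letter i p)" "rank i p = j" "word i ! j = letter i p"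
  using filter_nth_position[OF assms[unfolded word_def]] filter_nth_take(2)
  unfolding rank_def word_def by metis

section \<open>Half-edges on circles that keep an arrow\<close>

definition gluing :: "(('c \<times> nat) \<times> ('c \<times> nat)) set" where
  "gluing = {(h, across L h) | h. h \<in> half_edges L} \<union> {(h, thr' h) | h. h \<in> half_edges L}"

lemma gluing_iff: "(h, h') \<in> gluing \<longleftrightarrow> h \<in> half_edges L \<and> (h' = across L h \<or> h' = thr' h)"
  unfolding gluing_def by blast

text \<open>The other half-edges lie on circles whose words become empty, which
  \<open>num_boundary\<close> counts apart from the components of arrow ends.\<close>

definition marked :: "('c \<times> nat) set" where
  "marked = {h \<in> half_edges L. word (fst (position h)) \<noteq> []}"

lemma marked_letter:
  assumes "i < length hss" "p < length (hss ! i)"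
  shows "letter i p \<in> marked \<longleftrightarrow> word i \<noteq> []" "thr (letter i p) \<in> marked \<longleftrightarrow> word i \<noteq> []"
  using position_letter[OF assms] letter_half_edge[OF assms] through_letter_half_edge[OF assms]
  by (simp_all add: marked_def)

lemma in_F_marked:
  assumes "h \<in> half_edges L" "in_F h"
  shows "h \<in> marked"
proof -
  obtain i p where ip: "lies_at (i, p) h" using ex_lies_at assms(1) by blast
  then have "in_F (letter i p)" "letter i p \<in> set (hss ! i)"
    using assms(2) by (auto simp: lies_at_def)
  then have "word i \<noteq> []" unfolding word_def filter_empty_conv by blast
  then show ?thesis using position_eq[OF ip] assms(1) by (simp add: marked_def)
qed

lemma Suc_mod_length: "p < length xs \<Longrightarrow> Suc p mod length xs < length xs"
  by (cases xs) auto

lemma marked_through: "h \<in> half_edges L \<Longrightarrow> thr h \<in> marked \<longleftrightarrow> h \<in> marked"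
proof -
  assume h: "h \<in> half_edges L"
  then obtain i p where "lies_at (i, p) h" using ex_lies_at by blast
  then have "i < length hss" "p < length (hss ! i)" "h = letter i p \<or> h = thr (letter i p)"
    by (simp_all add: lies_at_def)
  then show ?thesis
    using marked_letter through_through_letter by metis
qed

lemma cyclic_predecessor:
  assumes "i < length hss" "p < length (hss ! i)"
  obtains p' where "p' < length (hss ! i)" "p = Suc p' mod length (hss ! i)"
proof (cases p)
  case 0
  then show thesis using that[of "length (hss ! i) - 1"] assms by simp
next
  case (Suc p')
  then show thesis using that[of p'] assms by simp
qed

lemma marked_across: "h \<in> half_edges L \<Longrightarrow> across L h \<in> marked \<longleftrightarrow> h \<in> marked"
proof -
  assume h: "h \<in> half_edges L"
  then obtain i p where ip: "lies_at (i, p) h" using ex_lies_at by blast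
  then have i: "i < length hss" "p < length (hss ! i)" "h = letter i p \<or> h = thr (letter i p)"
    by (simp_all add: lies_at_def)
  obtain p' where p': "p' < length (hss ! i)" "p = Suc p' mod length (hss ! i)"
    using cyclic_predecessor[OF i(1,2)] .
  have "across L (letter i p) = thr (letter i p')"
    using across_letter[OF i(1) p'(1)] p'(2) by simp
  moreover have "across L (thr (letter i p)) = letter i (Suc p mod length (hss ! i))"
    using across_through_letter[OF i(1,2)] .
  ultimately show ?thesis
    using i(3) marked_letter[OF i(1,2)] marked_letter[OF i(1) p'(1)]
      marked_letter[OF i(1) Suc_mod_length[OF i(2)]] by auto
qed

text \<open>At a crossing in \<open>F\<close> the new strand may lead to another circle, but all
  half-edges there are marked. Elsewhere it is the old strand and stays on its circle.\<close>

lemma marked_resplit: "h \<in> half_edges L \<Longrightarrow> thr' h \<in> marked \<longleftrightarrow> h \<in> marked"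
  using in_F_marked[of h] in_F_marked[of "thr' h"] resplit_half_edges[of h] resplit_eq[of h]
    marked_through[of h] by (cases "in_F h") simp_all

lemma gluing_marked:
  "(h, h') \<in> gluing \<Longrightarrow> h \<in> marked \<longleftrightarrow> h' \<in> marked"
  unfolding gluing_iff using marked_across[of h] marked_resplit[of h] by blast

lemma linked_next:
  assumes "i < length hss" "p < length (hss ! i)" "word i \<noteq> []"
  shows "(thr (letter i p), letter i (Suc p mod length (hss ! i))) \<in> linked marked gluing"
proof (rule linked_edge)
  show "(thr (letter i p), letter i (Suc p mod length (hss ! i))) \<in> gluing"
    using across_through_letter[OF assms(1,2)] through_letter_half_edge[OF assms(1,2)]
    by (simp add: gluing_iff)
qed (simp_all add: marked_letter assms Suc_mod_length)

lemma linked_through: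
  assumes "i < length hss" "p < length (hss ! i)" "word i \<noteq> []" "\<not> in_F (letter i p)"
  shows "(letter i p, thr (letter i p)) \<in> linked marked gluing"
proof (rule linked_edge)
  show "(letter i p, thr (letter i p)) \<in> gluing"
    using resplit_eq[OF letter_half_edge[OF assms(1,2)] assms(4)] letter_half_edge[OF assms(1,2)]
    by (simp add: gluing_iff)
qed (simp_all add: marked_letter assms)

text \<open>Going forward over letters outside \<open>F\<close> uses old strands, which persist in
  the new state, so the walk reaches the next surviving letter, if necessary past the end of the
  list.\<close>

lemma linked_word:
  assumes "i < length hss" "p < length (hss ! i)" "word i \<noteq> []"
  shows "(letter i p, word i ! (rank i p mod length (word i))) \<in> linked marked gluing"
proof -
  have step: "(letter i p, letter i (Suc p mod length (hss ! i))) \<in> linked marked gluing"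
    if "p < length (hss ! i)" "\<not> in_F (letter i p)" for p
    using linked_through[OF assms(1) that(1) assms(3) that(2)] linked_next[OF assms(1) that(1) assms(3)]
    by (rule linked_trans)
  have before: "(letter i p, word i ! rank i p) \<in> linked marked gluing"
    if "p < length (hss ! i)" "rank i p < length (word i)" for p
    using that
  proof (induction "length (hss ! i) - p" arbitrary: p rule: less_induct)
    case less
    show ?case
    proof (cases "in_F (letter i p)")
      case True
      then show ?thesis using word_rank less.prems by simp
    next
      case False
      \<comment> \<open>A non-surviving letter in the last position would already have the full rank
        \<open>length (word i)\<close>.\<close>
      have "Suc p \<noteq> length (hss ! i)"
        using False less.prems rank_Suc[of p i] rank_length[of i] by auto
      then have p: "Suc p < length (hss ! i)" using less.prems by simp
      have r: "rank i (Suc p) = rank i p" using False less.prems rank_Suc[of p i] by simp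
      have "(letter i p, letter i (Suc p)) \<in> linked marked gluing"
        using step[OF less.prems(1) False] p by simp
      also have "(letter i (Suc p), word i ! rank i (Suc p)) \<in> linked marked gluing"
        by (rule less.hyps) (use p r less.prems in simp_all)
      finally show ?thesis unfolding r .
    qed
  qed
  show ?thesis
  proof (cases "rank i p < length (word i)")
    case True
    then show ?thesis using before assms by simp
  next
    case False
    then have full: "rank i p = length (word i)" using rank_le[of i p] by simp
    \<comment> \<open>Nothing survives from \<open>p\<close> on, so the walk runs to the end of the
      list and wraps round to position 0, whose rank 0 is the full rank modulo
      \<open>length (word i)\<close>.\<close>
    have "(letter i p, letter i 0) \<in> linked marked gluing"
      using assms(2) full
    proof (induction "length (hss ! i) - p" arbitrary: p rule: less_induct)
      case less
      have F: "\<not> in_F (letter i p)" using word_rank[OF less.prems(1)] less.prems(2) by linarith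
      note st = step[OF less.prems(1) F]
      show ?case
      proof (cases "Suc p = length (hss ! i)")
        case True
        then show ?thesis using st by simp
      next
        case False
        then have p: "Suc p < length (hss ! i)" using less.prems by simp
        have "(letter i p, letter i (Suc p)) \<in> linked marked gluing" using st p by simp
        also have "(letter i (Suc p), letter i 0) \<in> linked marked gluing"
          by (rule less.hyps) (use p F less.prems rank_Suc[of p i] in simp_all)
        finally show ?thesis .
      qed
    qed
    also have "(letter i 0, word i ! rank i 0) \<in> linked marked gluing"
      by (rule before) (use assms in auto)
    finally show ?thesis using full by simp
  qed
qed

end

section \<open>Ends of the surviving arrows\<close>

locale resplit_graph = resplit_state L s hss F
  for L :: "'c virtual_link_diagram" and s hss F +
  fixes G :: "'c signed_ribbon_graph"
  assumes circles_G: "circles G = map (arrow_word L s) hss @ replicate (loops L) []"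
begin

abbreviation "subgraph \<equiv> spanning_subgraph G F"

lemma filter_arrow_word:
  "filter (\<lambda>a. fst a \<in> F) (arrow_word L s hs) = map (\<lambda>h. (fst h, start h)) (filter in_F hs)"
  unfolding arrow_word_def using F
  by (induction hs) (auto simp: in_F_def start_def)

lemma circles_subgraph:
  "circles subgraph = map (\<lambda>hs. map (\<lambda>h. (fst h, start h)) (filter in_F hs)) hss @ replicate (loops L) []"
  by (simp add: spanning_subgraph_def circles_G filter_arrow_word)

lemma length_circles: "length (circles subgraph) = length hss + loops L"
  by (simp add: circles_subgraph)

lemma circle_nth: "i < length hss \<Longrightarrow> circles subgraph ! i = map (\<lambda>h. (fst h, start h)) (word i)"
  by (simp add: circles_subgraph nth_append word_def)

lemma circle_nth_loop:
  "length hss \<le> i \<Longrightarrow> i < length (circles subgraph) \<Longrightarrow> circles subgraph ! i = []"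
  by (simp add: circles_subgraph nth_append)

lemma arrows_subgraph: "(i, j) \<in> arrows subgraph \<longleftrightarrow> i < length hss \<and> j < length (word i)"
proof (cases "i < length hss")
  case True
  then show ?thesis by (simp add: arrows_def length_circles circle_nth)
next
  case False
  then show ?thesis using circle_nth_loop[of i] by (auto simp: arrows_def)
qed

lemma arrow_ends_subgraph: "(i, j, b) \<in> arrow_ends subgraph \<longleftrightarrow> (i, j) \<in> arrows subgraph"
  by (simp add: arrow_ends_def)

definition end_point :: "nat \<times> nat \<times> bool \<Rightarrow> 'c \<times> nat" where
  "end_point = (\<lambda>(i, j, b). if b then thr (word i ! j) else word i ! j)"

text \<open>
  A half-edge that is no end of a surviving arrow is moved forward along its circle to the next
  arrow. This is a homotopy inverse of \<open>end_point\<close>.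
\<close>

definition arrow_end :: "'c \<times> nat \<Rightarrow> nat \<times> nat \<times> bool" where
  "arrow_end h = (case position h of (i, p) \<Rightarrow>
     (i, rank i p mod length (word i), in_F h \<and> h \<noteq> letter i p))"

lemma arrow_end_letter:
  assumes "i < length hss" "p < length (hss ! i)"
  shows "arrow_end (letter i p) = (i, rank i p mod length (word i), False)"
    and "arrow_end (thr (letter i p)) = (i, rank i p mod length (word i), in_F (letter i p))"
  using assms position_letter letter_neq_through[OF assms(1,2,2)] by (simp_all add: arrow_end_def)

lemma arrow_end_end_point:
  assumes "v \<in> arrow_ends subgraph"
  shows "arrow_end (end_point v) = v" "end_point v \<in> half_edges L" "in_F (end_point v)"
proof -
  obtain i j b where v: "v = (i, j, b)" "i < length hss" "j < length (word i)"
    using assms arrows_subgraph arrow_ends_subgraph by (metis prod_cases3)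
  obtain p where p: "p < length (hss ! i)" "in_F (letter i p)" "rank i p = j" "word i ! j = letter i p"
    using word_position[OF v(3)] .
  show "arrow_end (end_point v) = v" "end_point v \<in> half_edges L" "in_F (end_point v)"
    using p v arrow_end_letter[OF v(2) p(1)] letter_half_edge[OF v(2) p(1)]
      through_letter_half_edge[OF v(2) p(1)]
    by (cases b; simp add: end_point_def)+
qed

lemma end_point_arrow_end:
  assumes "h \<in> half_edges L" "in_F h"
  shows "arrow_end h \<in> arrow_ends subgraph" "end_point (arrow_end h) = h"
proof -
  obtain i p where "lies_at (i, p) h" using ex_lies_at assms(1) by blast
  then have ip: "i < length hss" "p < length (hss ! i)" and h: "h = letter i p \<or> h = thr (letter i p)"
    by (simp_all add: lies_at_def)
  moreover have "in_F (letter i p)" using h assms(2) by auto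
  ultimately show "arrow_end h \<in> arrow_ends subgraph" "end_point (arrow_end h) = h"
    using arrow_end_letter[OF ip] word_rank[OF ip(2)]
    by (auto simp: arrow_ends_subgraph arrows_subgraph end_point_def)
qed

text \<open>Off \<open>F\<close> the half-edge itself is not recovered, only its class. Being marked
  ensures a non-empty word, so that the reduced rank is a valid index.\<close>

lemma arrow_end_marked:
  assumes "h \<in> marked"
  shows "arrow_end h \<in> arrow_ends subgraph" "(h, end_point (arrow_end h)) \<in> linked marked gluing"
proof -
  have hE: "h \<in> half_edges L" using assms by (simp add: marked_def)
  then obtain i p where "lies_at (i, p) h" using ex_lies_at by blast
  then have ip: "i < length hss" "p < length (hss ! i)" and h: "h = letter i p \<or> h = thr (letter i p)"
    by (simp_all add: lies_at_def)
  have w: "word i \<noteq> []" using h assms marked_letter[OF ip] by auto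
  show "arrow_end h \<in> arrow_ends subgraph"
    using w ip h arrow_end_letter[OF ip] by (auto simp: arrow_ends_subgraph arrows_subgraph)
  show "(h, end_point (arrow_end h)) \<in> linked marked gluing"
  proof (cases "in_F h")
    case True
    then show ?thesis using end_point_arrow_end(2)[OF hE] by simp
  next
    case False
    then have nF: "\<not> in_F (letter i p)" using h by auto
    have "(h, letter i p) \<in> linked marked gluing"
      using h linked_sym[OF linked_through[OF ip w nF]] by auto
    also have "(letter i p, word i ! (rank i p mod length (word i))) \<in> linked marked gluing"
      using linked_word[OF ip w] .
    also have "word i ! (rank i p mod length (word i)) = end_point (arrow_end h)"
      using h nF arrow_end_letter[OF ip] by (auto simp: end_point_def)
    finally show ?thesis .
  qed
qed

text \<open>If the arrow follows the circle, its letter is a start and the head is the second end;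
  otherwise the letter is no start and is the head itself. Either way the head is the end that is
  not a start.\<close>

lemma arrow_label_end_point:
  assumes "p \<in> arrows subgraph"
  shows "arrow_head subgraph p \<in> arrow_ends subgraph" "arrow_tail subgraph p \<in> arrow_ends subgraph"
    "fst (end_point (arrow_head subgraph p)) = arrow_label subgraph p"
    "fst (end_point (arrow_tail subgraph p)) = arrow_label subgraph p"
    "\<not> start (end_point (arrow_head subgraph p))" "start (end_point (arrow_tail subgraph p))"
    "thr (end_point (arrow_head subgraph p)) = end_point (arrow_tail subgraph p)"
proof -
  obtain i j where p: "p = (i, j)" "i < length hss" "j < length (word i)"
    using assms arrows_subgraph by (metis surj_pair)
  have "(i, j, False) \<in> arrow_ends subgraph"
    using assms p by (simp add: arrow_ends_subgraph)
  from arrow_end_end_point(2,3)[OF this]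
  have w: "word i ! j \<in> half_edges L" "in_F (word i ! j)" by (simp_all add: end_point_def)
  show "arrow_head subgraph p \<in> arrow_ends subgraph" "arrow_tail subgraph p \<in> arrow_ends subgraph"
    "fst (end_point (arrow_head subgraph p)) = arrow_label subgraph p"
    "fst (end_point (arrow_tail subgraph p)) = arrow_label subgraph p"
    "\<not> start (end_point (arrow_head subgraph p))" "start (end_point (arrow_tail subgraph p))"
    "thr (end_point (arrow_head subgraph p)) = end_point (arrow_tail subgraph p)"
    using p assms start_through(1)[OF w] through_half_edges[OF w(1)]
    by (simp_all add: arrow_head_def arrow_tail_def arrow_label_def end_point_def circle_nth
        arrow_ends_subgraph)
qed

lemma arrow_end_cases:
  assumes "h \<in> half_edges L" "in_F h"
  obtains p where "p \<in> arrows subgraph" "arrow_label subgraph p = fst h"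
    "arrow_end h = (if start h then arrow_tail subgraph p else arrow_head subgraph p)"
proof -
  obtain i j b where v: "arrow_end h = (i, j, b)" by (metis prod_cases3)
  then have p: "(i, j) \<in> arrows subgraph"
    using end_point_arrow_end(1)[OF assms] by (simp add: arrow_ends_subgraph)
  have "arrow_end h = arrow_head subgraph (i, j) \<or> arrow_end h = arrow_tail subgraph (i, j)"
    by (auto simp: v arrow_head_def arrow_tail_def)
  then show thesis
    using that[OF p] arrow_label_end_point(3-6)[OF p] end_point_arrow_end(2)[OF assms] by auto
qed

lemma arrow_tail_inj: "arrow_tail subgraph p = arrow_tail subgraph q \<Longrightarrow> p = q"
  by (auto simp: arrow_tail_def split: prod.splits)

section \<open>Free arcs and sides against diagram edges and new strands\<close>

lemma end_point_free_side:
  assumes "(v, v') \<in> free_sides subgraph"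
  shows "(end_point v, end_point v') \<in> linked marked gluing"
proof -
  obtain p q where pq: "v = arrow_head subgraph p" "v' = arrow_tail subgraph q"
    "p \<in> arrows subgraph" "q \<in> arrows subgraph" "p \<noteq> q"
    "arrow_label subgraph p = arrow_label subgraph q"
    using assms by (auto simp: free_sides_def)
  note P = arrow_label_end_point[OF pq(3)] and Q = arrow_label_end_point[OF pq(4)]
  note hp = arrow_end_end_point[OF P(1)] and hq = arrow_end_end_point[OF Q(2)]
  have "end_point v' = thr (end_point v) \<or> end_point v' = thr' (end_point v)"
    unfolding pq(1,2) by (rule start_through(3)) (use hp hq P Q pq(6) in simp_all)
  \<comment> \<open>The old strand leads from the head of \<open>p\<close> to the tail of
    \<open>p\<close> itself, which \<open>p \<noteq> q\<close> excludes.\<close>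
  moreover have "end_point v' \<noteq> thr (end_point v)"
    using P(7) pq(1,2,5) hq(1) arrow_end_end_point(1)[OF P(2)] arrow_tail_inj by metis
  ultimately have "end_point v' = thr' (end_point v)" by simp
  moreover have "end_point v \<in> marked" "end_point v' \<in> marked"
    using hp hq in_F_marked by (simp_all add: pq(1,2))
  ultimately show ?thesis
    using hp(2) pq(1) by (intro linked_edge) (simp_all add: gluing_iff)
qed

text \<open>The letter met right after a surviving arrow need not survive;
  \<open>linked_word\<close> goes on from it to the next one that does, and
  \<open>rank_Suc_mod\<close> identifies its index.\<close>

lemma end_point_free_arc:
  assumes "(v, v') \<in> free_arcs subgraph"
  shows "(end_point v, end_point v') \<in> linked marked gluing"
proof -
  obtain i j where v: "v = (i, j, True)" "v' = (i, Suc j mod length (circles subgraph ! i), False)"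
    "(i, j) \<in> arrows subgraph"
    using assms by (auto simp: free_arcs_def)
  then have ij: "i < length hss" "j < length (word i)" by (simp_all add: arrows_subgraph)
  then have len: "length (circles subgraph ! i) = length (word i)" by (simp add: circle_nth)
  have w: "word i \<noteq> []" using ij by auto
  obtain p where p: "p < length (hss ! i)" "in_F (letter i p)" "rank i p = j" "word i ! j = letter i p"
    using word_position[OF ij(2)] .
  let ?q = "Suc p mod length (hss ! i)"
  have "end_point v = thr (letter i p)" by (simp add: v end_point_def p)
  also have "(thr (letter i p), letter i ?q) \<in> linked marked gluing"
    using linked_next[OF ij(1) p(1) w] .
  also have "(letter i ?q, word i ! (rank i ?q mod length (word i))) \<in> linked marked gluing"
    using linked_word[OF ij(1) Suc_mod_length[OF p(1)] w] .
  also have "word i ! (rank i ?q mod length (word i)) = end_point v'"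
    using rank_Suc_mod[OF p(1)] p by (simp add: v end_point_def len)
  finally show ?thesis .
qed

text \<open>A diagram edge yields a free arc only if it leaves a surviving arrow. Otherwise both of
  its ends are moved forward to the same arrow end.\<close>

lemma arrow_end_across_letter:
  assumes i: "i < length hss" "p < length (hss ! i)" and w: "word i \<noteq> []"
  shows "(arrow_end (thr (letter i p)), arrow_end (letter i (Suc p mod length (hss ! i))))
    \<in> linked (arrow_ends subgraph) (free_arcs subgraph \<union> free_sides subgraph)"
proof (cases "in_F (letter i p)")
  case True
  have r: "rank i p < length (word i)" using word_rank[OF i(2) True] by simp
  have "((i, rank i p, True), (i, Suc (rank i p) mod length (word i), False)) \<in> free_arcs subgraph"
    using r i by (auto simp: free_arcs_def arrows_subgraph circle_nth)
  moreover have "(i, rank i p, True) \<in> arrow_ends subgraph"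
    "(i, Suc (rank i p) mod length (word i), False) \<in> arrow_ends subgraph"
    using r i w by (simp_all add: arrow_ends_subgraph arrows_subgraph)
  ultimately show ?thesis
    using True r arrow_end_letter[OF i] arrow_end_letter(1)[OF i(1) Suc_mod_length[OF i(2)]]
      rank_Suc_mod[OF i(2)]
    by (auto intro: linked_edge)
next
  case False
  then show ?thesis
    using arrow_end_letter[OF i] arrow_end_letter(1)[OF i(1) Suc_mod_length[OF i(2)]]
      rank_Suc_mod[OF i(2)] by simp
qed

lemma arrow_end_across:
  assumes "h \<in> marked"
  shows "(arrow_end h, arrow_end (across L h))
    \<in> linked (arrow_ends subgraph) (free_arcs subgraph \<union> free_sides subgraph)"
proof -
  have hE: "h \<in> half_edges L" using assms by (simp add: marked_def)
  then obtain i p where "lies_at (i, p) h" using ex_lies_at by blast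
  then have ip: "i < length hss" "p < length (hss ! i)" and h: "h = letter i p \<or> h = thr (letter i p)"
    by (simp_all add: lies_at_def)
  have w: "word i \<noteq> []" using h assms marked_letter[OF ip] by auto
  from h show ?thesis
  proof
    assume h: "h = letter i p"
    \<comment> \<open>Here \<open>h\<close> is an entering half-edge, so its edge comes from the
      preceding passage.\<close>
    obtain p' where p': "p' < length (hss ! i)" "p = Suc p' mod length (hss ! i)"
      using cyclic_predecessor[OF ip] .
    have "across L h = thr (letter i p')" using across_letter[OF ip(1) p'(1)] h p'(2) by simp
    then show ?thesis
      using linked_sym[OF arrow_end_across_letter[OF ip(1) p'(1) w]] h p'(2) by simp
  next
    assume h: "h = thr (letter i p)"
    then show ?thesis
      using arrow_end_across_letter[OF ip w] across_through_letter[OF ip] by simp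
  qed
qed

text \<open>Free sides are directed from head to tail, so this case is direct; a half-edge that is a
  start is reduced to it by the involution \<open>thr'\<close>.\<close>

lemma arrow_end_resplit_head:
  assumes h: "h \<in> half_edges L" "in_F h" "\<not> start h"
  shows "(arrow_end h, arrow_end (thr' h))
    \<in> linked (arrow_ends subgraph) (free_arcs subgraph \<union> free_sides subgraph)"
proof -
  have h': "thr' h \<in> half_edges L" "in_F (thr' h)" "start (thr' h)"
    using h resplit_half_edges[OF h(1)] start_through(2)[OF h(1,2)] by simp_all
  obtain p where p: "p \<in> arrows subgraph" "arrow_label subgraph p = fst h"
    "arrow_end h = arrow_head subgraph p"
    using arrow_end_cases[OF h(1,2)] h(3) by auto
  obtain q where q: "q \<in> arrows subgraph" "arrow_label subgraph q = fst h"
    "arrow_end (thr' h) = arrow_tail subgraph q"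
    using arrow_end_cases[OF h'(1,2)] h'(3) by auto
  have "p \<noteq> q"
  proof
    assume "p = q"
    then have "thr' h = thr h"
      using arrow_label_end_point(7)[OF p(1)] p(3) q(3) end_point_arrow_end(2)[OF h(1,2)]
        end_point_arrow_end(2)[OF h'(1,2)] by simp
    then show False using start_through(4)[OF h(1,2)] by simp
  qed
  then have "(arrow_end h, arrow_end (thr' h)) \<in> free_sides subgraph"
    unfolding free_sides_def mem_Collect_eq
    by (intro exI[of _ p] exI[of _ q]) (simp add: p q)
  then show ?thesis
    using end_point_arrow_end(1)[OF h(1,2)] end_point_arrow_end(1)[OF h'(1,2)]
    by (intro linked_edge) simp_all
qed

lemma arrow_end_resplit:
  assumes "h \<in> marked"
  shows "(arrow_end h, arrow_end (thr' h))
    \<in> linked (arrow_ends subgraph) (free_arcs subgraph \<union> free_sides subgraph)"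
proof -
  have h: "h \<in> half_edges L" using assms by (simp add: marked_def)
  show ?thesis
  proof (cases "in_F h")
    case True
    note h' = resplit_half_edges[OF h]
    show ?thesis
    proof (cases "start h")
      case False
      then show ?thesis using arrow_end_resplit_head h True by blast
    next
      case st: True
      have "\<not> start (thr' h)" using start_through(2)[OF h True] st by simp
      then show ?thesis
        using arrow_end_resplit_head[of "thr' h"] h' True by (auto intro: linked_sym)
    qed
  next
    case False
    obtain i p where "lies_at (i, p) h" using ex_lies_at h by blast
    then have ip: "i < length hss" "p < length (hss ! i)" and hp: "h = letter i p \<or> h = thr (letter i p)"
      by (simp_all add: lies_at_def)
    have "\<not> in_F (letter i p)" using hp False by auto
    \<comment> \<open>A strand outside \<open>F\<close> collapses: both its ends are moved to the
      same arrow end.\<close>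
    then have "arrow_end (thr h) = arrow_end h"
      using hp arrow_end_letter[OF ip] through_through_letter[OF ip] by auto
    then show ?thesis using resplit_eq[OF h False] by simp
  qed
qed

lemma card_marked_components:
  "card (graph_components marked gluing)
    = card (graph_components (arrow_ends subgraph) (free_arcs subgraph \<union> free_sides subgraph))"
proof (rule card_graph_components_eq[where f = arrow_end and g = end_point])
  show "end_point v \<in> marked" if "v \<in> arrow_ends subgraph" for v
    using arrow_end_end_point[OF that] in_F_marked by simp
  show "(arrow_end h, arrow_end h') \<in> linked (arrow_ends subgraph) (free_arcs subgraph \<union> free_sides subgraph)"
    if "(h, h') \<in> gluing" "h \<in> marked" for h h'
    using that(1) arrow_end_across[OF that(2)] arrow_end_resplit[OF that(2)] unfolding gluing_iff by (elim conjE disjE) simp_all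
  show "(end_point v, end_point v') \<in> linked marked gluing"
    if "(v, v') \<in> free_arcs subgraph \<union> free_sides subgraph" for v v'
    using that end_point_free_arc[of v v'] end_point_free_side[of v v'] by blast
qed (simp_all add: arrow_end_marked arrow_end_end_point)

section \<open>Circles that lose all their arrows\<close>

lemma traversal_resplit:
  assumes "i < length hss" "word i = []" "p < length (hss ! i)"
  shows "letter i p \<in> half_edges L - marked" "thr' (letter i p) = thr (letter i p)"
proof -
  have "\<not> in_F (letter i p)" using assms word_rank[of p i] by auto
  then show "letter i p \<in> half_edges L - marked" "thr' (letter i p) = thr (letter i p)"
    using assms marked_letter[OF assms(1,3)] letter_half_edge[OF assms(1,3)] resplit_eq by simp_all
qed

text \<open>No letter of such a circle lies in \<open>F\<close>, so old and new strands agree along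
  it and it is a circle of the new state as well.\<close>

lemma unmarked_circle:
  assumes i: "i < length hss" "word i = []"
  shows "traversed_circle L s (hss ! i) = linked (half_edges L - marked) gluing `` {letter i 0}"
proof -
  let ?U = "half_edges L - marked"
  \<comment> \<open>\<open>orbit_list_component\<close> wants a relation built on the same set as
    the orbit. Cut down to \<open>?U\<close>, this one coincides with \<open>gluing\<close>.\<close>
  let ?R = "{(h, across L h) | h. h \<in> ?U} \<union> {(h, thr' h) | h. h \<in> ?U}"
  have ne: "hss ! i \<noteq> []" using traversals[of "hss ! i"] i by (simp add: traversal_def)
  have sub: "set (hss ! i) \<subseteq> ?U"
  proof
    fix x assume "x \<in> set (hss ! i)"
    then obtain p where "p < length (hss ! i)" "x = letter i p" by (metis in_set_conv_nth)
    then show "x \<in> ?U" using traversal_resplit(1)[OF i] by simp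
  qed
  have "set (hss ! i) \<union> thr' ` set (hss ! i) = ((?R \<union> ?R\<inverse>) \<inter> ?U \<times> ?U)\<^sup>* `` {letter i 0}"
  proof (rule orbit_list_component[OF _ _ ne sub _ refl])
    show "across L h \<in> ?U \<and> across L h \<noteq> h \<and> across L (across L h) = h" if "h \<in> ?U" for h
      using that across_half_edges[of h] marked_across[of h] by simp
    show "thr' h \<in> ?U \<and> thr' h \<noteq> h \<and> thr' (thr' h) = h" if "h \<in> ?U" for h
      using that resplit_half_edges[of h] marked_resplit[of h] by simp
    show "across L (thr' (letter i p)) = letter i (Suc p mod length (hss ! i))"
      if "p < length (hss ! i)" for p
      using that traversal_resplit(2)[OF i] across_through_letter[OF i(1)] by simp
  qed
  moreover have "(?R \<union> ?R\<inverse>) \<inter> ?U \<times> ?U = (gluing \<union> gluing\<inverse>) \<inter> ?U \<times> ?U"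
    unfolding gluing_def by blast
  moreover have "thr' ` set (hss ! i) = thr ` set (hss ! i)"
  proof (rule image_cong)
    fix x assume "x \<in> set (hss ! i)"
    then obtain p where "p < length (hss ! i)" "x = letter i p" by (metis in_set_conv_nth)
    then show "thr' x = thr x" using traversal_resplit(2)[OF i] by simp
  qed simp
  ultimately show ?thesis by (simp add: traversed_circle_def linked_def)
qed

lemma card_unmarked_components:
  "card (graph_components (half_edges L - marked) gluing) = card {i. i < length hss \<and> word i = []}"
proof -
  let ?I = "{i. i < length hss \<and> word i = []}" and ?U = "half_edges L - marked"
  have ne: "hss ! i \<noteq> []" if "i < length hss" for i
    using traversals[of "hss ! i"] that by (simp add: traversal_def)
  have "inj_on (\<lambda>i. traversed_circle L s (hss ! i)) ?I"
    using distinct_circles by (auto intro!: inj_onI simp: distinct_conv_nth)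
  moreover have "(\<lambda>i. traversed_circle L s (hss ! i)) ` ?I = graph_components ?U gluing"
  proof
    show "(\<lambda>i. traversed_circle L s (hss ! i)) ` ?I \<subseteq> graph_components ?U gluing"
      unfolding graph_components_linked
      using unmarked_circle traversal_resplit(1)[of _ 0] ne by auto
    show "graph_components ?U gluing \<subseteq> (\<lambda>i. traversed_circle L s (hss ! i)) ` ?I"
    proof
      fix X assume "X \<in> graph_components ?U gluing"
      then obtain h where h: "h \<in> ?U" "X = linked ?U gluing `` {h}"
        by (auto simp: graph_components_linked)
      then obtain i p where at: "lies_at (i, p) h" using ex_lies_at by blast
      then have i: "i < length hss" "p < length (hss ! i)" "h = letter i p \<or> h = thr (letter i p)"
        by (simp_all add: lies_at_def)
      have w: "word i = []" using h(1) i marked_letter[OF i(1,2)] by auto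
      have "h \<in> traversed_circle L s (hss ! i)" using i by (auto simp: traversed_circle_def)
      then have "(letter i 0, h) \<in> linked ?U gluing" unfolding unmarked_circle[OF i(1) w] by simp
      then have "X = traversed_circle L s (hss ! i)"
        unfolding unmarked_circle[OF i(1) w] h(2) by (rule linked_class_eq[symmetric])
      then show "X \<in> (\<lambda>i. traversed_circle L s (hss ! i)) ` ?I" using i w by blast
    qed
  qed
  ultimately show ?thesis using card_image by fastforce
qed

lemma num_state_circles_resplit: "num_state_circles L (resplit L s F) = num_boundary subgraph"
proof -
  have "card (state_circles L (resplit L s F))
      = card (graph_components marked gluing) + card (graph_components (half_edges L - marked) gluing)"
    unfolding state_circles_def gluing_def[symmetric]
    by (rule card_graph_components_split[OF finite_half_edges _ gluing_marked]) (auto simp: marked_def)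
  \<comment> \<open>Empty circles have two sources: traversed circles with no letter in
    \<open>F\<close>, and the crossing-free curves, placed at the indices from
    \<open>length hss\<close> on.\<close>
  moreover have "{i. i < length (circles subgraph) \<and> circles subgraph ! i = []}
      = {i. i < length hss \<and> word i = []} \<union> {length hss..<length hss + loops L}"
    using circle_nth circle_nth_loop by (auto simp: length_circles not_less)
  then have "card {i. i < length (circles subgraph) \<and> circles subgraph ! i = []}
      = card {i. i < length hss \<and> word i = []} + loops L"
    by (simp add: card_Un_disjoint disjoint_iff)
  ultimately show ?thesis
    by (simp add: num_state_circles_def num_boundary_def card_marked_components card_unmarked_components)
qed

end

section \<open>The bracket and the polynomial\<close>

lemma edges_spanning_subgraph: "edges (spanning_subgraph G F) = edges G \<inter> F"
  by (auto simp: edges_def spanning_subgraph_def image_iff)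

lemma edge_sign_spanning_subgraph [simp]: "edge_sign (spanning_subgraph G F) = edge_sign G"
  by (simp add: spanning_subgraph_def)

text \<open>Formally the left side is \<open>x powi m * y powi n\<close> times the power of
  \<open>x / y\<close> with exponent \<open>\<sigma>\<close>, and \<open>x / y\<close> is the square
  of \<open>A / B\<close>. The roots matter only for non-integral \<open>\<sigma>\<close>, where
  \<open>t * u * z = 1\<close> fixes \<open>t / u\<close> as \<open>A / B\<close> and not its
  negative.\<close>

lemma half_power_mult_half_power:
  fixes A B d x y z t u :: "'a::field" and m n N :: int
  assumes nz: "A \<noteq> 0" "B \<noteq> 0" "d \<noteq> 0"
    and x: "x = A * d / B" and y: "y = B * d / A" and z: "z = 1 / d"
    and \<sigma>: "\<sigma> = of_int N / 2"
    and roots: "\<sigma> \<notin> \<int> \<Longrightarrow> t ^ 2 = x \<and> u ^ 2 = y \<and> t * u * z = 1"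
  shows "half_power x t (of_int m + \<sigma>) * half_power y u (of_int n - \<sigma>)
    = x powi m * y powi n * (A / B) powi N"
proof (cases "\<sigma> \<in> \<int>")
  case True
  then obtain j where j: "\<sigma> = of_int j" by (auto elim: Ints_cases)
  then have "(of_int N :: rat) = of_int (2 * j)" using \<sigma> by simp
  then have N: "N = 2 * j" by (simp only: of_int_eq_iff)
  have nz': "x \<noteq> 0" "y \<noteq> 0" using nz x y by simp_all
  have "half_power x t (of_int m + \<sigma>) = x powi (m + j)" "half_power y u (of_int n - \<sigma>) = y powi (n - j)"
    by (simp_all add: half_power_def j flip: of_int_add of_int_diff)
  then have "half_power x t (of_int m + \<sigma>) * half_power y u (of_int n - \<sigma>)
      = x powi m * y powi n * (x / y) powi j"
    using nz' by (simp add: power_int_add power_int_diff power_int_divide_distrib)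
  also have "x / y = (A / B) ^ 2" using nz by (simp add: x y field_simps power2_eq_square)
  also have "((A / B) ^ 2) powi j = (A / B) powi N"
    by (simp add: N power_int_mult)
  finally show ?thesis .
next
  case False
  then have t: "t ^ 2 = x" "u ^ 2 = y" "t * u * z = 1" using roots by auto
  then have nz': "t \<noteq> 0" "u \<noteq> 0" by auto
  have "of_int m + \<sigma> \<notin> \<int>" "of_int n - \<sigma> \<notin> \<int>"
    using False Ints_diff[of "of_int m + \<sigma>" "of_int m"] Ints_diff[of "of_int n" "of_int n - \<sigma>"] by auto
  moreover have "\<lfloor>2 * (of_int m + \<sigma>)\<rfloor> = 2 * m + N" "\<lfloor>2 * (of_int n - \<sigma>)\<rfloor> = 2 * n - N"
    by (simp_all add: \<sigma> algebra_simps floor_eq_iff)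
  ultimately have "half_power x t (of_int m + \<sigma>) * half_power y u (of_int n - \<sigma>)
      = t powi (2 * m + N) * u powi (2 * n - N)"
    by (simp add: half_power_def)
  also have "\<dots> = (t ^ 2) powi m * (u ^ 2) powi n * (t / u) powi N"
    using nz' by (simp add: power_int_add power_int_diff power_int_divide_distrib power_int_mult)
  \<comment> \<open>Expanding by \<open>t\<close> gives \<open>t ^ 2 / (t * u)\<close>, that is,
    \<open>x / d\<close>.\<close>
  also have "t / u = A / B"
  proof -
    have "t * u = d" using t(3) nz z by (simp add: field_simps)
    then have "t / u = t ^ 2 / d" using nz' by (auto simp: power2_eq_square)
    then show ?thesis using t(1) x nz by simp
  qed
  finally show ?thesis using t by simp
qed

text \<open>Here \<open>p\<close>, \<open>q\<close> and \<open>f\<close> stand for the numbers of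
  components, edges and boundary components of the subgraph. The \<open>p\<close>-th powers combine
  to a power of \<open>x * y * z ^ 2 = 1\<close>; what remains is governed by
  \<open>y * z = B / A\<close> and \<open>z = 1 / d\<close>.\<close>

lemma power_int_xyz:
  fixes A B d :: "'a::field" and p q f :: int
  assumes nz: "A \<noteq> 0" "B \<noteq> 0" "d \<noteq> 0"
  shows "(A * d / B) powi p * (B * d / A) powi (q + p) * (1 / d) powi (1 + 2 * p - f + q)
    = (B / A) powi q * d powi (f - 1)"
proof -
  define X Y Z where XYZ_def: "X = A * d / B" "Y = B * d / A" "Z = 1 / d"
  have XYZ: "X \<noteq> 0" "Y \<noteq> 0" "Z \<noteq> 0" and one: "X * Y * (Z * Z) = 1"
    using nz by (simp_all add: XYZ_def field_simps)
  have "1 + 2 * p - f + q = p + p + (q - (f - 1))" by simp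
  then have "Z powi (1 + 2 * p - f + q) = Z powi p * Z powi p * Z powi (q - (f - 1))"
    using XYZ by (simp only: power_int_add simp_thms)
  then have "X powi p * Y powi (q + p) * Z powi (1 + 2 * p - f + q)
    = (X * Y * (Z * Z)) powi p * (Y powi q * Z powi (q - (f - 1)))"
    using XYZ by (simp add: power_int_add power_int_mult_distrib)
  also have "\<dots> = Y powi q * Z powi (q - (f - 1))"
    unfolding one by simp
  also have "\<dots> = (B / A) powi q * d powi (f - 1)"
    using nz by (simp add: XYZ_def power_int_diff power_int_mult_distrib power_int_divide_distrib)
  finally show ?thesis unfolding XYZ_def .
qed

theorem theorem6p3:
  fixes L :: "'c virtual_link_diagram" and s :: "'c \<Rightarrow> splitting" and G :: "'c signed_ribbon_graph"
    and A B d x y z t u :: "'a::field" and e v k :: nat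
  assumes "virtual_link_diagram L"
    and "e = card (classical L)"
    and "s \<in> states L"
    and "state_ribbon_graph L s G"
    and "v = num_vertices G"
    and "k = num_components G"
    and "A \<noteq> 0" and "B \<noteq> 0" and "d \<noteq> 0"
    and "x = A * d / B" and "y = B * d / A" and "z = 1 / d"
    and "half_integer_exponents G \<longrightarrow> t ^ 2 = x \<and> u ^ 2 = y \<and> t * u * z = 1"
  shows "e = num_edges G \<and>
    kauffman_bracket L A B d
      = A ^ e * (x ^ k * y ^ v * z ^ (v + 1) * bollobas_riordan G x t y u z)"
proof -
  obtain hss where hss: "\<forall>hs \<in> set hss. traversal L s hs"
      "distinct (map (traversed_circle L s) hss)"
      "traversed_circle L s ` set hss = state_circles L s"
    and circles: "circles G = map (arrow_word L s) hss @ replicate (loops L) []"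
    using assms(4) unfolding state_ribbon_graph_def by blast
  interpret state_traversals L s hss
    by unfold_locales (use assms(1) hss in auto)
  have edges: "edges G = classical L" using circles by (rule edges_state_graph)
  have sgn: "edge_sign G c = -1 \<longleftrightarrow> s c = Split_B" if "c \<in> classical L" for c
    using that assms(4) by (cases "s c") (auto simp: state_ribbon_graph_def)
  have fin: "finite (classical L)"
    using assms(1) by (simp add: virtual_link_diagram_def classical_def)
  have nz: "x \<noteq> 0" "y \<noteq> 0" "z \<noteq> 0" using assms(7-12) by auto
  have neg: "num_neg_edges (spanning_subgraph G F) = card {c \<in> F. s c = Split_B}"
    if "F \<subseteq> classical L" for F
  proof -
    have "{c \<in> edges (spanning_subgraph G F). edge_sign (spanning_subgraph G F) c = -1}
        = {c \<in> F. s c = Split_B}"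
      using that sgn by (auto simp: edges_spanning_subgraph edges)
    then show ?thesis by (simp add: num_neg_edges_def)
  qed
  have state: "A ^ card {c \<in> classical L. resplit L s F c = Split_A}
      * B ^ card {c \<in> classical L. resplit L s F c = Split_B}
      * d powi (int (num_state_circles L (resplit L s F)) - 1)
    = A ^ e * (x ^ k * y ^ v * z ^ (v + 1) *
       (let H = spanning_subgraph G F; \<sigma> = sign_shift G F in
          half_power x t (of_int (ribbon_rank G - ribbon_rank H) + \<sigma>)
        * half_power y u (of_int (ribbon_nullity H) - \<sigma>)
        * z powi (int (num_components H) - int (num_boundary H) + ribbon_nullity H)))"
    if F: "F \<subseteq> classical L" for F
  proof -
    interpret resplit_graph L s hss F G by unfold_locales (use F circles in auto)
    \<comment> \<open>The splittings of \<open>s\<close>, counted by kind inside and outside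
      \<open>F\<close>. Resplitting exchanges the kinds inside \<open>F\<close> only, which gives
      the counts \<open>b + a'\<close> and \<open>a + b'\<close> below.\<close>
    define a b a' b' where "a = card {c \<in> F. s c = Split_A}" and "b = card {c \<in> F. s c = Split_B}"
      and "a' = card {c \<in> classical L - F. s c = Split_A}"
      and "b' = card {c \<in> classical L - F. s c = Split_B}"
    define p f where "p = int (num_components subgraph)" and "f = int (num_boundary subgraph)"
    have finF: "finite F" using F fin finite_subset by blast
    have sp: "m = Split_B \<longleftrightarrow> m \<noteq> Split_A" for m by (cases m) auto
    have cardF: "card F = a + b"
      unfolding a_def b_def sp using card_Int_Diff[OF finF, of "{c. s c = Split_A}"]
      by (simp add: Int_def set_diff_eq)
    have cardF': "card (classical L - F) = a' + b'"
      unfolding a'_def b'_def sp using card_Int_Diff[of "classical L - F" "{c. s c = Split_A}"] fin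
      by (simp add: Int_def set_diff_eq)
    have e: "e = a + b + a' + b'"
      using cardF cardF' card_Diff_subset[OF finF F] card_mono[OF fin F] assms(2) by simp
    have "{c \<in> classical L. resplit L s F c = Split_A}
        = {c \<in> F. s c = Split_B} \<union> {c \<in> classical L - F. s c = Split_A}"
      using F sp by (auto simp: resplit_iff split: if_splits)
    then have alpha: "card {c \<in> classical L. resplit L s F c = Split_A} = b + a'"
      unfolding b_def a'_def using finF fin by (simp add: card_Un_disjoint disjoint_iff)
    have "{c \<in> classical L. resplit L s F c = Split_B}
        = {c \<in> F. s c = Split_A} \<union> {c \<in> classical L - F. s c = Split_B}"
      using F sp by (auto simp: resplit_iff split: if_splits)
    then have beta: "card {c \<in> classical L. resplit L s F c = Split_B} = a + b'"
      unfolding a_def b'_def using finF fin by (simp add: card_Un_disjoint disjoint_iff)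
    have shift: "sign_shift G F = of_int (int b - int b') / 2"
      using neg[OF F] neg[of "classical L - F"] by (simp add: sign_shift_def edges b_def b'_def)
    have roots: "t ^ 2 = x \<and> u ^ 2 = y \<and> t * u * z = 1" if "sign_shift G F \<notin> \<int>"
      using that F assms(13) by (auto simp: half_integer_exponents_def edges)
    have numE: "num_edges subgraph = a + b"
      using F cardF by (simp add: num_edges_def edges_spanning_subgraph edges Int_absorb1)
    have numV: "num_vertices subgraph = v"
      using assms(5) by (simp add: num_vertices_def spanning_subgraph_def)
    have rank: "ribbon_rank G - ribbon_rank subgraph = p - int k"
      and null: "ribbon_nullity subgraph = int (a + b) + p - int v"
      using numV assms(5,6) numE by (simp_all add: ribbon_rank_def ribbon_nullity_def p_def)
    have halves: "half_power x t (of_int m + sign_shift G F) * half_power y u (of_int n - sign_shift G F)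
        = x powi m * y powi n * (A / B) powi (int b - int b')" for m n
      by (rule half_power_mult_half_power[OF assms(7-12) shift]) (use roots in blast)
    let ?T = "x ^ k * y ^ v * z ^ (v + 1) *
       (half_power x t (of_int (ribbon_rank G - ribbon_rank subgraph) + sign_shift G F)
        * half_power y u (of_int (ribbon_nullity subgraph) - sign_shift G F)
        * z powi (p - f + ribbon_nullity subgraph))"
    \<comment> \<open>The prefactors remove the data of the whole graph: \<open>x ^ k\<close>
      cancels the \<open>- k\<close> of the rank difference, and \<open>y ^ v\<close> and
      \<open>z ^ v\<close> cancel the \<open>- v\<close> of the nullity. The one extra factor
      \<open>z\<close> turns into the \<open>- 1\<close> in the exponent of
      \<open>d\<close>.\<close>
    have "?T
      = (x powi int k * x powi (p - int k)) * (y powi int v * y powi (int (a + b) + p - int v))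
        * (z powi int (v + 1) * z powi (p - f + (int (a + b) + p - int v)))
        * (A / B) powi (int b - int b')"
      unfolding rank null halves by (simp only: power_int_of_nat mult_ac)
    also have "\<dots> = x powi p * y powi (int (a + b) + p) * z powi (1 + 2 * p - f + int (a + b))
        * (A / B) powi (int b - int b')"
      using nz by (simp only: power_int_add[symmetric] simp_thms) (simp add: algebra_simps)
    also have "\<dots> = (B / A) powi int (a + b) * d powi (f - 1) * (A / B) powi (int b - int b')"
      unfolding assms(10-12) power_int_xyz[OF assms(7-9)] ..
    finally have R: "?T = (B / A) powi int (a + b) * d powi (f - 1) * (A / B) powi (int b - int b')" .
    \<comment> \<open>The exponent of \<open>A\<close> on the right is
      \<open>e - (a + b) + (b - b') = b + a'\<close>, and that of \<open>B\<close> is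
      \<open>(a + b) - (b - b') = a + b'\<close>.\<close>
    have "A ^ (b + a') * B ^ (a + b') * d powi (f - 1)
      = A ^ e * ((B / A) powi int (a + b) * d powi (f - 1) * (A / B) powi (int b - int b'))"
      using assms(7,8) unfolding e
      by (simp add: power_int_divide_distrib power_int_diff power_int_add power_add field_simps)
    then show ?thesis
      unfolding alpha beta num_state_circles_resplit Let_def p_def[symmetric] f_def[symmetric] R .
  qed
  have "kauffman_bracket L A B d = (\<Sum>F \<in> Pow (classical L).
      A ^ card {c \<in> classical L. resplit L s F c = Split_A}
      * B ^ card {c \<in> classical L. resplit L s F c = Split_B}
      * d powi (int (num_state_circles L (resplit L s F)) - 1))"
    unfolding kauffman_bracket_def
    by (rule sum.reindex_bij_betw[OF bij_betw_resplit[OF assms(3)], symmetric])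
  also have "\<dots> = A ^ e * (x ^ k * y ^ v * z ^ (v + 1) * bollobas_riordan G x t y u z)"
    unfolding bollobas_riordan_def edges sum_distrib_left
    by (rule sum.cong) (use state in auto)
  finally show ?thesis
    using assms(2) by (simp add: num_edges_def edges)
qed

end
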